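(* Let $0<T_0<T_1$ and let $(\xi(t))_{t\in(T_0,T_1)}$ be a family of stationary and ergodic simple point processes on $\mathbb{R}^n$ having all finite moments. Let $(\mathfrak{p}(t))_{t\in(T_0,T_1)}$ be the associated family of persistence diagram expectation measures. Assume that all $\mathfrak{p}(t)$ exist, are non-zero, and that the family scales self-similarly between $T_0$ and $T_1$ with exponents $\eta_1,\eta_2\in\mathbb{R}$, i.e. for all $t,t'\in(T_0,T_1)$, every bounded Borel set $A\subset\mathbb{R}^n$ and every Borel set $B\subseteq\Delta$, $$\mathfrak{p}(t,A)(B)=(t/t')^{-\eta_2}\,\mathfrak{p}(t',A)\big((t/t')^{-\eta_1}B\big).$$ If the interval $(T_0,T_1)$ is sufficiently extended (in the sense defined in the context), then almost surely $$\eta_2=n\,\eta_1 .$$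
   Context: Point processes. $(\Omega,\mathcal{E},\mathbb{P})$ is a probability space, $\mathcal{B}^n_b$ the bounded Borel subsets of $\mathbb{R}^n$, $\lambda_n$ Lebesgue measure. A point process on $\mathbb{R}^n$ is a random integer-valued boundedly finite measure $\xi$; it is simple if a.s. all its atoms are distinct; it has all finite moments if $\mathbb{E}[\xi(A)^k]<\infty$ for all $k\ge1$, $A\in\mathcal{B}^n_b$. It is stationary if its distribution is invariant under all translations $\theta_x$, $(\theta_x\xi)(A)=\xi(A+x)$, and ergodic if it is stationary and $\mathbb{P}(\xi\in\mathcal{A})\in\{0,1\}$ for every translation-invariant Borel set $\mathcal{A}$ of boundedly finite measures. Standing assumption: $\mathbb{E}[\xi(A)]>0$ whenever $A\in\mathcal{B}^n_b$ and $\lambda_n(A)>0$. For a simple point process, $X_{\xi_\omega}(A)$ denotes the (a.s. finite) set of atoms of $\xi_\omega$ in $A$. Persistence. $\Delta=\{(b,d)\in\mathbb{R}^2: b<d\}$, and $\kappa B=\{(\kappa b,\kappa d):(b,d)\in B\}$. For a finite $X\subset\mathbb{R}^n$, $\check C_r(X)=\{\sigma\subseteq X:\bigcap_{x\in\sigma}B_r(x)\neq\emptyset\}$ is the Čech complex, and $\mathrm{Dgm}_\ell(X)$ is the $\ell$-th persistence diagram (finite multiset of points $(b,d)\in\Delta$, birth/death radii; pairs of zero persistence ignored) of the filtration $(\check C_r(X))_r$, with homology over a fixed field. $\mathrm{pers}((b,d))=d-b$, $d((b,d))=d$. For $A\in\mathcal{B}^n_b$ let $\rho_\omega(A)=\sum_{x\in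 D}\delta_x$ with $D=\bigcup_{\ell=0}^{n-1}\mathrm{Dgm}_\ell(X_{\xi_\omega}(A))$ (multiset union); $\rho$ is the persistence diagram measure. The persistence diagram expectation measure is the map $A\mapsto\mathfrak{p}(A)=\mathbb{E}[\rho_\omega(A)]$ from $\mathcal{B}^n_b$ to Radon measures on $\Delta$, if it exists. For a family $\xi(t)$ write $\rho_\omega(t,A)$ and $\mathfrak{p}(t,A)=\mathfrak{p}(t)(A)$. Geometric quantities (argument $t$ added for families): $n_\omega(A)=\rho_\omega(A)(\Delta)$; $l_{q,\omega}(A)=\big[\frac1{n_\omega(A)}\int_\Delta\mathrm{pers}(x)^q\rho_\omega(A)(dx)\big]^{1/q}$ for $q>0$; $d_{\max,\omega}(A)$ is the maximal death $d$ among atoms $(b,d)$ of $\rho_\omega(A)$; $\mathfrak{n}(A)=\mathfrak{p}(A)(\Delta)$; $\mathfrak{l}_q(A)=\big[\frac1{\mathfrak{n}(A)}\int_\Delta\mathrm{pers}(x)^q\mathfrak{p}(A)(dx)\big]^{1/q}$; $\mathfrak{d}_{\max}(A)=\lim_{p\to\infty}\big[\int_\Delta d(x)^p\mathfrak{p}(A)(dx)\big]^{1/p}$. Convex averaging sequence: $\{A_k\}\subset\mathcal{B}^n_b$ with each $A_k$ convex, $A_k\subseteq A_{k+1}$, and $\sup\{r: A_k\text{ contains a ball of radius }r\}\to\infty$. It is balanced if $W_{n-1}(A_k)=O(\lambda_n(A_k)^{1/n})$ for large $k$, where $W_i(C)=V(C,\dots,C,B_1(0),\dots,B_1(0))$ ($n-i$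 copies of $C$, $i$ copies of the unit ball, $V$ the mixed volume) is the $i$-th quermassintegral. Sufficiently extended. $(T_0,T_1)$ is sufficiently extended if, in case $\eta_2\ne n\eta_1$, there are a constant $c>0$ for which the packing inequality $n_\omega(t,A)\le\frac{c(n+2\delta)}{\delta}\frac{d_{\max,\omega}(t,A)^\delta}{l_{n+\delta,\omega}(t,A)^{n+\delta}}$ holds (for all $\delta>0$, $A\in\mathcal{B}^n_b$, $t\in(T_0,T_1)$, almost surely), a $\delta>0$, a balanced convex averaging sequence $\{A_k\}$, and $t,t'\in(T_0,T_1)$ such that for all sufficiently large $k$ $$\frac{t}{t'}>\left(\frac{c(n+2\delta)}{\delta}\max\left\{\frac{\mathfrak{d}_{\max}(t,A_k)^\delta}{\mathfrak{n}(t,A_k)\,\mathfrak{l}_{n+\delta}(t,A_k)^{n+\delta}},\frac{\mathfrak{d}_{\max}(t',A_k)^\delta}{\mathfrak{n}(t',A_k)\,\mathfrak{l}_{n+\delta}(t',A_k)^{n+\delta}}\right\}\right)^{1/|n\eta_1-\eta_2|}.$$ *)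

theory Defs
  imports "HOL-Probability.Probability" "HOL-Library.Poly_Mapping" "HOL-Library.Landau_Symbols"
begin

section \<open>Persistent homology of Cech filtrations\<close>

definition Delta :: "(real \<times> real) set" where
  "Delta = {(b, d). b < d}"

definition pers :: "real \<times> real \<Rightarrow> real" where
  "pers x = snd x - fst x"

definition cech_complex :: "'a::euclidean_space set \<Rightarrow> real \<Rightarrow> 'a set set" where
  "cech_complex X r = {\<sigma>. \<sigma> \<subseteq> X \<and> (\<Inter>x\<in>\<sigma>. cball x r) \<noteq> {}}"

text \<open>
  Simplicial chains are finitely supported functions from simplices to the coefficient field.
  The simplices are oriented by the enumeration \<^const>\<open>to_nat_on\<close> of the finite vertex set \<open>X\<close>;
  a different choice of enumeration gives an isomorphic chain complex.
\<close>

definition chain_scale :: "'k::field \<Rightarrow> ('a set \<Rightarrow>\<^sub>0 'k) \<Rightarrow> ('a set \<Rightarrow>\<^sub>0 'k)" where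
  "chain_scale a c = Poly_Mapping.map ((*) a) c"

lemma vector_space_chain_scale: "vector_space (chain_scale :: 'k::field \<Rightarrow> ('a set \<Rightarrow>\<^sub>0 'k) \<Rightarrow> _)"
proof -
  have lookup_scale: "Poly_Mapping.lookup (chain_scale a c) \<sigma> = a * Poly_Mapping.lookup c \<sigma>"
    for a :: 'k and c :: "'a set \<Rightarrow>\<^sub>0 'k" and \<sigma>
    by (simp add: chain_scale_def Poly_Mapping.map.rep_eq when_def)
  show ?thesis
    by unfold_locales
       (auto intro!: poly_mapping_eqI simp: lookup_scale lookup_add algebra_simps)
qed

definition chains :: "nat \<Rightarrow> 'a set set \<Rightarrow> ('a set \<Rightarrow>\<^sub>0 'k::field) set" where
  "chains l K = {c. Poly_Mapping.keys c \<subseteq> {\<sigma> \<in> K. finite \<sigma> \<and> card \<sigma> = l + 1}}"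

text \<open>The homology is not reduced: the boundary of a vertex is \<open>0\<close>.\<close>

definition simplex_boundary :: "'a set \<Rightarrow> 'a set \<Rightarrow> ('a set \<Rightarrow>\<^sub>0 'k::field)" where
  "simplex_boundary X \<sigma> =
     (if card \<sigma> \<le> 1 then 0
      else \<Sum>v\<in>\<sigma>. Poly_Mapping.single (\<sigma> - {v})
             ((-1) ^ card {w \<in> \<sigma>. to_nat_on X w < to_nat_on X v}))"

definition boundary :: "'a set \<Rightarrow> ('a set \<Rightarrow>\<^sub>0 'k::field) \<Rightarrow> ('a set \<Rightarrow>\<^sub>0 'k)" where
  "boundary X c = (\<Sum>\<sigma>\<in>Poly_Mapping.keys c.
      chain_scale (Poly_Mapping.lookup c \<sigma>) (simplex_boundary X \<sigma>))"

definition cycles :: "'a set \<Rightarrow> nat \<Rightarrow> 'a set set \<Rightarrow> ('a set \<Rightarrow>\<^sub>0 'k::field) set" where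
  "cycles X l K = {c \<in> chains l K. boundary X c = 0}"

definition boundaries :: "'a set \<Rightarrow> nat \<Rightarrow> 'a set set \<Rightarrow> ('a set \<Rightarrow>\<^sub>0 'k::field) set" where
  "boundaries X l K = boundary X ` chains (l + 1) K"

text \<open>
  The rank of \<open>H\<^sub>l(C\<^sub>r(X)) \<rightarrow> H\<^sub>l(C\<^sub>s(X))\<close>, i.e. the dimension of the persistent
  homology group \<open>Z\<^sub>l(C\<^sub>r(X)) / (Z\<^sub>l(C\<^sub>r(X)) \<inter> B\<^sub>l(C\<^sub>s(X)))\<close>, for \<open>r \<le> s\<close>.
  All spaces are finite-dimensional when \<open>X\<close> is finite.
\<close>

definition persistent_betti ::
    "'k::field itself \<Rightarrow> nat \<Rightarrow> 'a::euclidean_space set \<Rightarrow> real \<Rightarrow> real \<Rightarrow> nat" where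
  "persistent_betti k l X r s =
     (let Z = cycles X l (cech_complex X r) :: ('a set \<Rightarrow>\<^sub>0 'k) set;
          B = boundaries X l (cech_complex X s) :: ('a set \<Rightarrow>\<^sub>0 'k) set
      in vector_space.dim chain_scale Z - vector_space.dim chain_scale (Z \<inter> B))"

text \<open>
  The number of classes born at radius \<open>b\<close> and dying at radius \<open>d\<close>, by the usual
  inclusion-exclusion formula. Balls are closed, so the filtration is right-continuous
  and such a class lives on the half-open interval \<open>b \<le> r < d\<close>. The expression is
  constant for all small \<open>\<epsilon> > 0\<close>.
\<close>

definition pd_mult :: "'k::field itself \<Rightarrow> nat \<Rightarrow> 'a::euclidean_space set \<Rightarrow> real \<Rightarrow> real \<Rightarrow> nat" where
  "pd_mult k l X b d = (THE m. \<forall>\<^sub>F \<epsilon> in at_right 0. int m =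
       (int (persistent_betti k l X b (d - \<epsilon>)) - int (persistent_betti k l X b d))
     - (int (persistent_betti k l X (b - \<epsilon>) (d - \<epsilon>)) - int (persistent_betti k l X (b - \<epsilon>) d)))"

text \<open>
  Only points of \<open>\<Delta> \<subseteq> \<real>\<^sup>2\<close> are recorded, so the class of degree 0 that never dies
  does not contribute. For finite \<open>X\<close> the multiplicity function has finite support.
\<close>

definition Dgm :: "'k::field itself \<Rightarrow> nat \<Rightarrow> 'a::euclidean_space set \<Rightarrow> (real \<times> real) multiset" where
  "Dgm k l X = Abs_multiset (\<lambda>(b, d). if (b, d) \<in> Delta then pd_mult k l X b d else 0)"


section \<open>Point processes\<close>

definition bounded_borel :: "'a::euclidean_space set set" where
  "bounded_borel = {A \<in> sets borel. bounded A}"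

text \<open>
  The space of boundedly finite measures. Its \<open>\<sigma>\<close>-algebra is generated by the evaluations
  \<open>\<mu> \<mapsto> \<mu>(A)\<close> at bounded Borel sets, which is the Borel \<open>\<sigma>\<close>-algebra of the
  weak-hash topology.
\<close>

definition bf_measures :: "'a::euclidean_space measure measure" where
  "bf_measures = (SUP A \<in> bounded_borel. vimage_algebra
     {\<mu>. sets \<mu> = sets borel \<and> (\<forall>A\<in>bounded_borel. emeasure \<mu> A < \<infinity>)}
     (\<lambda>\<mu>. emeasure \<mu> A) borel)"

definition point_process :: "'w measure \<Rightarrow> ('w \<Rightarrow> 'a::euclidean_space measure) \<Rightarrow> bool" where
  "point_process M \<xi> \<longleftrightarrow> \<xi> \<in> M \<rightarrow>\<^sub>M bf_measures \<and>
     (\<forall>\<omega>\<in>space M. \<forall>A\<in>bounded_borel. \<exists>m::nat. emeasure (\<xi> \<omega>) A = of_nat m)"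

definition simple_process :: "'w measure \<Rightarrow> ('w \<Rightarrow> 'a::euclidean_space measure) \<Rightarrow> bool" where
  "simple_process M \<xi> \<longleftrightarrow> (AE \<omega> in M. \<forall>x. emeasure (\<xi> \<omega>) {x} \<le> 1)"

definition all_finite_moments :: "'w measure \<Rightarrow> ('w \<Rightarrow> 'a::euclidean_space measure) \<Rightarrow> bool" where
  "all_finite_moments M \<xi> \<longleftrightarrow>
     (\<forall>m\<ge>1::nat. \<forall>A\<in>bounded_borel. (\<integral>\<^sup>+\<omega>. emeasure (\<xi> \<omega>) A ^ m \<partial>M) < \<infinity>)"

text \<open>\<open>(\<theta>\<^sub>x \<mu>)(A) = \<mu>(A + x)\<close>\<close>

definition shift :: "'a::euclidean_space \<Rightarrow> 'a measure \<Rightarrow> 'a measure" where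
  "shift x \<mu> = distr \<mu> borel (\<lambda>y. y - x)"

definition stationary :: "'w measure \<Rightarrow> ('w \<Rightarrow> 'a::euclidean_space measure) \<Rightarrow> bool" where
  "stationary M \<xi> \<longleftrightarrow>
     (\<forall>x. distr M bf_measures (\<lambda>\<omega>. shift x (\<xi> \<omega>)) = distr M bf_measures \<xi>)"

definition ergodic :: "'w measure \<Rightarrow> ('w \<Rightarrow> 'a::euclidean_space measure) \<Rightarrow> bool" where
  "ergodic M \<xi> \<longleftrightarrow> stationary M \<xi> \<and>
     (\<forall>\<A>\<in>sets bf_measures. (\<forall>x. shift x ` \<A> = \<A>) \<longrightarrow>
        measure M {\<omega> \<in> space M. \<xi> \<omega> \<in> \<A>} \<in> {0, 1})"

definition positive_intensity :: "'w measure \<Rightarrow> ('w \<Rightarrow> 'a::euclidean_space measure) \<Rightarrow> bool" where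
  "positive_intensity M \<xi> \<longleftrightarrow>
     (\<forall>A\<in>bounded_borel. emeasure lborel A > 0 \<longrightarrow> (\<integral>\<^sup>+\<omega>. emeasure (\<xi> \<omega>) A \<partial>M) > 0)"

definition atoms_in :: "'a::euclidean_space measure \<Rightarrow> 'a set \<Rightarrow> 'a set" where
  "atoms_in \<mu> A = {x \<in> A. emeasure \<mu> {x} > 0}"


section \<open>Persistence diagram measures\<close>

definition pd_union :: "'k::field itself \<Rightarrow> 'a::euclidean_space set \<Rightarrow> (real \<times> real) multiset" where
  "pd_union k X = (\<Sum>l<DIM('a). Dgm k l X)"

text \<open>The measure \<open>\<Sum>\<^bsub>x\<in>D\<^esub> \<delta>\<^sub>x\<close> on \<open>\<Delta>\<close>.\<close>

definition diagram_measure :: "(real \<times> real) multiset \<Rightarrow> (real \<times> real) measure" where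
  "diagram_measure D = measure_of Delta (sets (restrict_space borel Delta))
     (\<lambda>B. of_nat (size (filter_mset (\<lambda>x. x \<in> B) D)))"

text \<open>\<open>pd_measure k \<xi> \<omega> A\<close> is \<open>\<rho>\<^sub>\<omega>(A)\<close> and \<open>pd_expectation k M \<xi> A\<close> is \<open>E[\<rho>\<^sub>\<omega>(A)]\<close>.\<close>

definition pd_measure ::
    "'k::field itself \<Rightarrow> ('w \<Rightarrow> 'a::euclidean_space measure) \<Rightarrow> 'w \<Rightarrow> 'a set \<Rightarrow> (real \<times> real) measure" where
  "pd_measure k \<xi> \<omega> A = diagram_measure (pd_union k (atoms_in (\<xi> \<omega>) A))"

definition pd_expectation ::
    "'k::field itself \<Rightarrow> 'w measure \<Rightarrow> ('w \<Rightarrow> 'a::euclidean_space measure) \<Rightarrow> 'a set \<Rightarrow>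
     (real \<times> real) measure" where
  "pd_expectation k M \<xi> A = measure_of Delta (sets (restrict_space borel Delta))
     (\<lambda>B. \<integral>\<^sup>+\<omega>. emeasure (pd_measure k \<xi> \<omega> A) B \<partial>M)"

text \<open>
  Existence: the expectations are expectations of random variables and define a Radon measure
  on \<open>\<Delta>\<close>. On the locally compact, second countable space \<open>\<Delta>\<close> a Borel measure is Radon iff
  it is finite on compact sets.
\<close>

definition pd_expectation_exists ::
    "'k::field itself \<Rightarrow> 'w measure \<Rightarrow> ('w \<Rightarrow> 'a::euclidean_space measure) \<Rightarrow> bool" where
  "pd_expectation_exists k M \<xi> \<longleftrightarrow> (\<forall>A\<in>bounded_borel.
     (\<forall>B\<in>sets borel. B \<subseteq> Delta \<longrightarrow> (\<lambda>\<omega>. emeasure (pd_measure k \<xi> \<omega> A) B) \<in> borel_measurable M) \<and>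
     (\<forall>C. compact C \<and> C \<subseteq> Delta \<longrightarrow> emeasure (pd_expectation k M \<xi> A) C < \<infinity>))"

text \<open>
  The geometric quantities, as functionals of a measure \<open>\<mu>\<close> on \<open>\<Delta>\<close>: \<open>n\<close> and \<open>l\<^sub>q\<close> are the
  first two at \<open>\<mu> = \<rho>\<^sub>\<omega>(A)\<close> or \<open>\<mu> = E[\<rho>\<^sub>\<omega>(A)]\<close>. For the empty diagram \<open>mean_pers\<close> is \<open>0\<close> and
  \<open>max_death\<close> is unspecified; the packing inequality below then reads \<open>0 \<le> 0\<close>.
  When \<open>\<xi>\<close> has all finite moments, \<open>E[\<rho>\<^sub>\<omega>(A)]\<close> is a finite measure with bounded support, so its
  quantities are given by convergent integrals and an existing limit.
\<close>

definition pd_number :: "(real \<times> real) measure \<Rightarrow> real" where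
  "pd_number \<mu> = measure \<mu> Delta"

definition mean_pers :: "real \<Rightarrow> (real \<times> real) measure \<Rightarrow> real" where
  "mean_pers q \<mu> = (1 / pd_number \<mu> * (\<integral>x. pers x powr q \<partial>\<mu>)) powr (1 / q)"

definition max_death :: "(real \<times> real) measure \<Rightarrow> real" where
  "max_death \<mu> = Max (snd ` {x \<in> Delta. emeasure \<mu> {x} > 0})"

definition max_death_expectation :: "(real \<times> real) measure \<Rightarrow> real" where
  "max_death_expectation \<mu> = Lim at_top (\<lambda>p::real. (\<integral>x. snd x powr p \<partial>\<mu>) powr (1 / p))"


section \<open>Balanced convex averaging sequences\<close>

definition minkowski_comb :: "real list \<Rightarrow> 'a::euclidean_space set list \<Rightarrow> 'a set" where
  "minkowski_comb cs Ks =
     {(\<Sum>i<length Ks. (cs ! i) *\<^sub>R x i) | x. \<forall>i<length Ks. x i \<in> Ks ! i}"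

text \<open>
  By Minkowski's theorem the volume of \<open>c\<^sub>1 K\<^sub>1 + \<dots> + c\<^sub>n K\<^sub>n\<close> (\<open>c\<^sub>i \<ge> 0\<close>) is
  \<open>\<Sum> V(K\<^bsub>i1\<^esub>, \<dots>, K\<^bsub>in\<^esub>) c\<^bsub>i1\<^esub> \<cdots> c\<^bsub>in\<^esub>\<close> with unique symmetric coefficients; the mixed
  volume is the coefficient for the index tuple \<open>(1, \<dots>, n)\<close>. Minkowski sums of convex sets are
  convex, hence Lebesgue (but not necessarily Borel) measurable.
\<close>

definition mixed_volume :: "'a::euclidean_space set list \<Rightarrow> real" where
  "mixed_volume Ks = (THE v. \<exists>V :: nat list \<Rightarrow> real.
     (let J = {js. length js = DIM('a) \<and> set js \<subseteq> {..<length Ks}} in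
        (\<forall>js\<in>J. \<forall>js'\<in>J. mset js = mset js' \<longrightarrow> V js = V js') \<and>
        (\<forall>cs. length cs = length Ks \<and> (\<forall>c\<in>set cs. 0 \<le> c) \<longrightarrow>
           measure lebesgue (minkowski_comb cs Ks) =
             (\<Sum>js\<in>J. V js * prod_list (map ((!) cs) js))) \<and>
        v = V [0..<DIM('a)]))"

definition quermassintegral :: "nat \<Rightarrow> 'a::euclidean_space set \<Rightarrow> real" where
  "quermassintegral i C = mixed_volume (replicate (DIM('a) - i) C @ replicate i (cball 0 1))"

definition convex_averaging :: "(nat \<Rightarrow> 'a::euclidean_space set) \<Rightarrow> bool" where
  "convex_averaging A \<longleftrightarrow>
     (\<forall>k. A k \<in> bounded_borel \<and> convex (A k) \<and> A k \<subseteq> A (Suc k)) \<and>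
     filterlim (\<lambda>k. Sup {r. 0 \<le> r \<and> (\<exists>x. ball x r \<subseteq> A k)}) at_top sequentially"

definition balanced :: "(nat \<Rightarrow> 'a::euclidean_space set) \<Rightarrow> bool" where
  "balanced A \<longleftrightarrow> (\<lambda>k. quermassintegral (DIM('a) - 1) (A k))
     \<in> O(\<lambda>k. measure lborel (A k) powr (1 / real DIM('a)))"


section \<open>Self-similar scaling and sufficiently extended time intervals\<close>

definition self_similar ::
    "'k::field itself \<Rightarrow> 'w measure \<Rightarrow> (real \<Rightarrow> 'w \<Rightarrow> 'a::euclidean_space measure) \<Rightarrow>
     real \<Rightarrow> real \<Rightarrow> real \<Rightarrow> real \<Rightarrow> bool" where
  "self_similar k M \<xi> T0 T1 \<eta>1 \<eta>2 \<longleftrightarrow>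
     (\<forall>t\<in>{T0<..<T1}. \<forall>t'\<in>{T0<..<T1}. \<forall>A\<in>bounded_borel. \<forall>B\<in>sets borel. B \<subseteq> Delta \<longrightarrow>
        emeasure (pd_expectation k M (\<xi> t) A) B =
          ennreal ((t / t') powr (- \<eta>2)) *
          emeasure (pd_expectation k M (\<xi> t') A)
            ((\<lambda>(b, d). ((t / t') powr (- \<eta>1) * b, (t / t') powr (- \<eta>1) * d)) ` B))"

definition packing_inequality ::
    "'k::field itself \<Rightarrow> 'w measure \<Rightarrow> (real \<Rightarrow> 'w \<Rightarrow> 'a::euclidean_space measure) \<Rightarrow>
     real \<Rightarrow> real \<Rightarrow> real \<Rightarrow> bool" where
  "packing_inequality k M \<xi> T0 T1 c \<longleftrightarrow>
     (\<forall>\<delta>::real. \<delta> > 0 \<longrightarrow> (\<forall>A\<in>bounded_borel. \<forall>t\<in>{T0<..<T1}. AE \<omega> in M.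
        pd_number (pd_measure k (\<xi> t) \<omega> A) \<le>
          c * (real DIM('a) + 2 * \<delta>) / \<delta> *
          (max_death (pd_measure k (\<xi> t) \<omega> A) powr \<delta> /
           mean_pers (real DIM('a) + \<delta>) (pd_measure k (\<xi> t) \<omega> A) powr (real DIM('a) + \<delta>))))"

definition extent_ratio :: "real \<Rightarrow> real \<Rightarrow> (real \<times> real) measure \<Rightarrow> real" where
  "extent_ratio n \<delta> \<mu> =
     max_death_expectation \<mu> powr \<delta> / (pd_number \<mu> * mean_pers (n + \<delta>) \<mu> powr (n + \<delta>))"

definition sufficiently_extended ::
    "'k::field itself \<Rightarrow> 'w measure \<Rightarrow> (real \<Rightarrow> 'w \<Rightarrow> 'a::euclidean_space measure) \<Rightarrow>
     real \<Rightarrow> real \<Rightarrow> real \<Rightarrow> real \<Rightarrow> bool" where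
  "sufficiently_extended k M \<xi> T0 T1 \<eta>1 \<eta>2 \<longleftrightarrow>
     (\<eta>2 \<noteq> real DIM('a) * \<eta>1 \<longrightarrow>
      (\<exists>c::real. c > 0 \<and> packing_inequality k M \<xi> T0 T1 c \<and>
        (\<exists>\<delta>::real. \<delta> > 0 \<and> (\<exists>A :: nat \<Rightarrow> 'a set. convex_averaging A \<and> balanced A \<and>
          (\<exists>t\<in>{T0<..<T1}. \<exists>t'\<in>{T0<..<T1}. \<forall>\<^sub>F j in sequentially.
            t / t' > (c * (real DIM('a) + 2 * \<delta>) / \<delta> *
                max (extent_ratio (real DIM('a)) \<delta> (pd_expectation k M (\<xi> t) (A j)))
                    (extent_ratio (real DIM('a)) \<delta> (pd_expectation k M (\<xi> t') (A j))))
              powr (1 / \<bar>real DIM('a) * \<eta>1 - \<eta>2\<bar>))))))"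

end

theory Submission
  imports Defs
begin

text \<open>
  Write \<open>n\<close> for the dimension, \<open>q = n + \<delta>\<close>, \<open>C = c (n + 2 \<delta>) / \<delta>\<close>, and fix one large set
  \<open>A\<^sub>k\<close> of the averaging sequence.

  Let \<open>N(\<mu>)\<close> be the total mass of \<open>\<mu>\<close> and \<open>P(t)\<close> the expectation measure at time \<open>t\<close>.
  Since \<open>N(\<mu>) l\<^sub>q(\<mu>)\<^sup>q = \<integral> pers\<^sup>q d\<mu>\<close>, the number of points cancels from the packing inequality: for
  almost every realisation with a non-empty diagram it says \<open>\<integral> pers\<^sup>q d\<rho> \<le> C d\<^sub>m\<^sub>a\<^sub>x(\<rho>)\<^sup>\<delta>\<close>. The limit of \<open>L\<^sup>p\<close> norms that
  defines the maximal death of the expectation measure is an essential supremum \<open>D\<close>, and almost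
  surely no point of \<open>\<rho>\<close> dies after \<open>D\<close>. The right-hand side is therefore at most the constant
  \<open>C D\<^sup>\<delta>\<close>, and taking expectations gives \<open>1 \<le> C E(t)\<close> for the extent ratio
  \<open>E(t) = D\<^sup>\<delta> / \<integral> pers\<^sup>q dP(t)\<close> of every time \<open>t\<close> (lemma \<open>extent_ratio_lower_bound\<close>).

  Self-similarity says that the expectation measure at time \<open>t\<close> is a multiple of a dilation of the
  one at time \<open>t'\<close>, so that \<open>E(t) = (t/t')\<^sup>a E(t')\<close> with \<open>a = \<eta>2 - n \<eta>1\<close> (lemma
  \<open>extent_ratio_rescale\<close>). Two numbers that are both at least \<open>1/C\<close> and have the ratio \<open>(t/t')\<^sup>a\<close>
  satisfy \<open>(t/t')\<^bsup>|a|\<^esup> \<le> C max (E(t)) (E(t'))\<close>; if \<open>a \<noteq> 0\<close>, this is exactly what a sufficiently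
  extended interval excludes.

  The argument divides by \<open>\<integral> pers\<^sup>q dP(t)\<close>, hence it needs an expectation measure that is finite and not
  zero. It is finite because the number of points in the diagram of \<open>m\<close> points of space is
  bounded by a polynomial in \<open>m\<close> (\<open>size_pd_union_le\<close>) and the point process has moments of all
  orders. It is non-zero for large \<open>k\<close> because the mean number of points in \<open>A\<^sub>k\<close> then exceeds one
  by stationarity (\<open>intensity_of_large_ball\<close>), so that \<open>A\<^sub>k\<close> contains two points with positive
  probability, and two points already produce a class of degree 0 that dies
  (\<open>pd_union_nonempty\<close>).
\<close>

section \<open>Dimensions of subspaces of a finitely spanned space\<close>

context vector_space
begin

lemma card_independent_le_dim:
  assumes "independent B" "B \<subseteq> V" "V \<subseteq> span F" "finite F"
  shows "finite B \<and> card B \<le> dim V"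
proof -
  obtain C where C: "C \<subseteq> V" "independent C" "V \<subseteq> span C" "card C = dim V"
    using basis_exists by blast
  have "finite C"
    using independent_span_bound[OF \<open>finite F\<close>, of C] C assms by auto
  then show ?thesis
    using independent_span_bound[of C B] C assms by auto
qed

lemma dim_le_dim_of_subset:
  assumes "U \<subseteq> V" "V \<subseteq> span F" "finite F"
  shows "dim U \<le> dim V"
proof -
  obtain B where "B \<subseteq> U" "independent B" "U \<subseteq> span B" "card B = dim U"
    using basis_exists by blast
  then show ?thesis
    using card_independent_le_dim[of B V F] assms by auto
qed

text \<open>
  This is the inequality \<open>dim (U1 + U2) \<le> dim U\<close> with \<open>dim (U1 + U2)\<close> expressed by the dimension formula.
  A basis of \<open>U1 \<inter> U2\<close> is extended to bases \<open>C\<close> of \<open>U1\<close> and \<open>D\<close> of \<open>U2\<close>; their union is still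
  independent, because a vector of \<open>D - C\<close> that depends on \<open>C\<close> and the rest of \<open>D\<close> gives an element of
  \<open>U1 \<inter> U2\<close> and so depends on the rest of \<open>D\<close> alone. The ambient space of chains is infinite-dimensional,
  therefore a finite spanning set \<open>F\<close> of \<open>U\<close> is a parameter.
\<close>

lemma dim_submodular:
  assumes sub: "subspace U1" "subspace U2" and U: "U1 \<union> U2 \<subseteq> U" "U \<subseteq> span F" "finite F"
  shows "dim U1 + dim U2 \<le> dim U + dim (U1 \<inter> U2)"
proof -
  obtain B where B: "B \<subseteq> U1 \<inter> U2" "independent B" "U1 \<inter> U2 \<subseteq> span B" "card B = dim (U1 \<inter> U2)"
    using basis_exists by blast
  obtain C where C: "B \<subseteq> C" "C \<subseteq> U1" "independent C" "U1 \<subseteq> span C"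
    using maximal_independent_subset_extend[of B U1] B by auto
  obtain D where D: "B \<subseteq> D" "D \<subseteq> U2" "independent D" "U2 \<subseteq> span D"
    using maximal_independent_subset_extend[of B U2] B by auto
  have spanC: "span C \<subseteq> U1" and spanD: "span D \<subseteq> U2"
    using C D sub by (auto simp: span_minimal)
  have fin: "finite C" "finite D"
    using card_independent_le_dim[of _ U F] C D U by auto
  have disj: "C \<inter> D = B"
  proof -
    have "d \<in> B" if "d \<in> C" "d \<in> D" for d
    proof (rule ccontr)
      assume "d \<notin> B"
      have "d \<in> span B" using B that C D by auto
      then have "d \<in> span (D - {d})"
        using span_mono[of B "D - {d}"] D \<open>d \<notin> B\<close> by auto
      then show False using D that dependent_def by blast
    qed
    then show ?thesis using C D by auto
  qed
  have indep: "independent (C \<union> D')" if "finite D'" "D' \<subseteq> D - B" for D'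
    using that
  proof (induction D' rule: finite_induct)
    case empty
    then show ?case using C by simp
  next
    case (insert d D')
    have "d \<notin> span (C \<union> D')"
    proof
      assume "d \<in> span (C \<union> D')"
      then obtain u v where uv: "d = u + v" "u \<in> span C" "v \<in> span D'"
        unfolding span_Un by auto
      have v: "v \<in> span D" using uv(3) insert.prems span_mono[of D' D] by auto
      have "d \<in> span D" using insert.prems by (auto intro: span_base)
      then have "u \<in> span D" using span_diff[OF _ v, of d] uv(1) by simp
      then have "u \<in> span B" using uv spanC spanD B by blast
      then have "d \<in> span (B \<union> D')" unfolding span_Un using uv by blast
      moreover have "B \<union> D' \<subseteq> D - {d}" using D insert by auto
      ultimately have "d \<in> span (D - {d})" using span_mono by blast
      then show False using D insert.prems dependent_def by blast
    qed
    then have "independent (insert d (C \<union> D'))"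
      using insert by (intro independent_insertI) auto
    then show ?case by simp
  qed
  have "independent (C \<union> (D - B))"
    by (rule indep) (use fin in auto)
  then have "card (C \<union> (D - B)) \<le> dim U"
    using card_independent_le_dim[of "C \<union> (D - B)" U F] C D U by blast
  moreover have "card (C \<union> (D - B)) = card C + (card D - card B)"
    using fin disj D card_Un_disjoint[of C "D - B"] card_Diff_subset[of B D] finite_subset[of B D]
    by auto
  moreover have "card C = dim U1" "card D = dim U2"
    using basis_card_eq_dim C D by auto
  moreover have "card B \<le> card D" using D fin card_mono by blast
  ultimately show ?thesis using B by linarith
qed

lemma dim_pos_of_nonzero:
  assumes "v \<in> V" "v \<noteq> 0" "V \<subseteq> span F" "finite F"
  shows "0 < dim V"
  using card_independent_le_dim[of "{v}" V F] assms by auto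

lemma dim_trivial:
  assumes "V \<subseteq> {0}"
  shows "dim V = 0"
  using dim_le_card[of V "{}"] assms by auto

end

section \<open>Chains of the Cech complex\<close>

interpretation chain: vector_space "chain_scale :: 'k::field \<Rightarrow> ('a set \<Rightarrow>\<^sub>0 'k) \<Rightarrow> _"
  by (rule vector_space_chain_scale)

lemma lookup_chain_scale [simp]:
  "Poly_Mapping.lookup (chain_scale a c) \<sigma> = a * Poly_Mapping.lookup c \<sigma>"
  by (simp add: chain_scale_def Poly_Mapping.map.rep_eq when_def)

lemma boundary_eq_sum:
  assumes "finite F" "Poly_Mapping.keys c \<subseteq> F"
  shows "boundary X c = (\<Sum>\<sigma>\<in>F. chain_scale (Poly_Mapping.lookup c \<sigma>) (simplex_boundary X \<sigma>))"
  unfolding boundary_def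
  by (rule sum.mono_neutral_left) (use assms in \<open>auto simp: in_keys_iff\<close>)

lemma boundary_add: "boundary X (c + c') = boundary X c + boundary X c'"
proof -
  let ?F = "Poly_Mapping.keys c \<union> Poly_Mapping.keys c'"
  have "Poly_Mapping.keys (c + c') \<subseteq> ?F"
    by (auto simp: in_keys_iff lookup_add)
  then show ?thesis
    by (simp add: boundary_eq_sum[of ?F] lookup_add chain.scale_left_distrib sum.distrib)
qed

lemma boundary_scale: "boundary X (chain_scale a c) = chain_scale a (boundary X c)"
proof -
  have "Poly_Mapping.keys (chain_scale a c) \<subseteq> Poly_Mapping.keys c"
    by (auto simp: in_keys_iff)
  then show ?thesis
    by (simp add: boundary_eq_sum[of "Poly_Mapping.keys c"] chain.scale_sum_right)
qed

lemma boundary_zero [simp]: "boundary X 0 = 0"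
  by (simp add: boundary_def)

lemma subspace_chains: "chain.subspace (chains l K)"
proof (rule chain.subspaceI)
  show "0 \<in> chains l K" by (simp add: chains_def)
  show "x + y \<in> chains l K" if "x \<in> chains l K" "y \<in> chains l K" for x y
    using that Poly_Mapping.keys_add[of x y] unfolding chains_def by blast
  show "chain_scale c x \<in> chains l K" if "x \<in> chains l K" for c x
  proof -
    have "Poly_Mapping.keys (chain_scale c x) \<subseteq> Poly_Mapping.keys x"
      by (auto simp: in_keys_iff)
    then show ?thesis using that unfolding chains_def by blast
  qed
qed

lemma subspace_cycles: "chain.subspace (cycles X l K)"
proof (rule chain.subspaceI)
  show "0 \<in> cycles X l K" using chain.subspace_0[OF subspace_chains] by (simp add: cycles_def)
  show "x + y \<in> cycles X l K" if "x \<in> cycles X l K" "y \<in> cycles X l K" for x y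
    using that chain.subspace_add[OF subspace_chains, of x l K y]
    by (auto simp: cycles_def boundary_add)
  show "chain_scale c x \<in> cycles X l K" if "x \<in> cycles X l K" for c x
    using that chain.subspace_scale[OF subspace_chains, of x l K c]
    by (auto simp: cycles_def boundary_scale)
qed

lemma subspace_boundaries: "chain.subspace (boundaries X l K)"
proof (rule chain.subspaceI)
  show "0 \<in> boundaries X l K"
    unfolding boundaries_def
    by (rule image_eqI[of _ _ 0]) (auto simp: chain.subspace_0[OF subspace_chains])
  show "x + y \<in> boundaries X l K" if xy: "x \<in> boundaries X l K" "y \<in> boundaries X l K" for x y
  proof -
    obtain c c' where "c \<in> chains (l + 1) K" "c' \<in> chains (l + 1) K" "x = boundary X c" "y = boundary X c'"
      using xy unfolding boundaries_def by blast
    then show ?thesis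
      unfolding boundaries_def
      by (intro image_eqI[of _ _ "c + c'"]) (auto simp only: boundary_add chain.subspace_add[OF subspace_chains])
  qed
  show "chain_scale a x \<in> boundaries X l K" if x: "x \<in> boundaries X l K" for a x
  proof -
    obtain c where "c \<in> chains (l + 1) K" "x = boundary X c"
      using x unfolding boundaries_def by blast
    then show ?thesis
      unfolding boundaries_def
      by (intro image_eqI[of _ _ "chain_scale a c"])
        (auto simp only: boundary_scale chain.subspace_scale[OF subspace_chains])
  qed
qed

lemma chains_subset_span:
  "chains l K \<subseteq> chain.span ((\<lambda>\<sigma>. Poly_Mapping.single \<sigma> (1::'k::field)) ` {\<sigma> \<in> K. finite \<sigma> \<and> card \<sigma> = l + 1})"
proof
  fix c :: "'a set \<Rightarrow>\<^sub>0 'k"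
  assume c: "c \<in> chains l K"
  have "c = (\<Sum>\<sigma>\<in>Poly_Mapping.keys c. chain_scale (Poly_Mapping.lookup c \<sigma>) (Poly_Mapping.single \<sigma> 1))"
    (is "c = ?r")
  proof (rule poly_mapping_eqI)
    fix \<tau>
    have "Poly_Mapping.lookup ?r \<tau> = (\<Sum>\<sigma>\<in>Poly_Mapping.keys c. if \<sigma> = \<tau> then Poly_Mapping.lookup c \<tau> else 0)"
      by (simp only: lookup_sum lookup_chain_scale, rule sum.cong) (auto simp: lookup_single when_def)
    also have "\<dots> = Poly_Mapping.lookup c \<tau>"
      by (simp add: in_keys_iff)
    finally show "Poly_Mapping.lookup c \<tau> = Poly_Mapping.lookup ?r \<tau>" by simp
  qed
  also have "\<dots> \<in> chain.span ((\<lambda>\<sigma>. Poly_Mapping.single \<sigma> 1) ` {\<sigma> \<in> K. finite \<sigma> \<and> card \<sigma> = l + 1})"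
    using c by (intro chain.span_sum chain.span_scale chain.span_base) (auto simp: chains_def)
  finally show "c \<in> chain.span ((\<lambda>\<sigma>. Poly_Mapping.single \<sigma> 1) ` {\<sigma> \<in> K. finite \<sigma> \<and> card \<sigma> = l + 1})" .
qed

definition simplices :: "nat \<Rightarrow> 'a set \<Rightarrow> 'a set set" where
  "simplices l X = {\<sigma>. \<sigma> \<subseteq> X \<and> finite \<sigma> \<and> card \<sigma> = l + 1}"

lemma finite_simplices: "finite X \<Longrightarrow> finite (simplices l X)"
  by (rule finite_subset[of _ "Pow X"]) (auto simp: simplices_def)

lemma binomial_le_power: "n choose k \<le> n ^ k"
proof (cases "k \<le> n")
  case True
  then show ?thesis by (rule binomial_le_pow)
qed (simp add: binomial_eq_0)

lemma card_simplices_le: "finite X \<Longrightarrow> card (simplices l X) \<le> card X ^ (l + 1)"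
proof -
  assume X: "finite X"
  have "simplices l X = {\<sigma>. \<sigma> \<subseteq> X \<and> card \<sigma> = l + 1}"
    using X finite_subset by (auto simp: simplices_def)
  then show ?thesis
    using n_subsets[OF X, of "l + 1"] binomial_le_power[of "card X" "l + 1"] by simp
qed

text \<open>
  This finite set spans the \<open>l\<close>-chains of every Cech complex on \<open>X\<close> and so bounds the dimension of the
  cycle spaces at all radii simultaneously.
\<close>

definition unit_chains :: "nat \<Rightarrow> 'a set \<Rightarrow> ('a set \<Rightarrow>\<^sub>0 'k::field) set" where
  "unit_chains l X = (\<lambda>\<sigma>. Poly_Mapping.single \<sigma> 1) ` simplices l X"

lemma finite_unit_chains: "finite X \<Longrightarrow> finite (unit_chains l X)"
  by (simp add: unit_chains_def finite_simplices)

lemma cycles_subset_span: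
  "cycles X l (cech_complex X r) \<subseteq> chain.span (unit_chains l X :: ('a::euclidean_space set \<Rightarrow>\<^sub>0 'k::field) set)"
proof -
  have "{\<sigma> \<in> cech_complex X r. finite \<sigma> \<and> card \<sigma> = l + 1} \<subseteq> simplices l X"
    by (auto simp: simplices_def cech_complex_def)
  then show ?thesis
    unfolding unit_chains_def cycles_def
    using chains_subset_span[of l "cech_complex X r", where ?'k = 'k] chain.span_mono[OF image_mono]
    by blast
qed

section \<open>The persistence diagram of a finite set\<close>

text \<open>
  Every simplex enters the Cech filtration at one radius, so the filtration is a step function of the
  radius and a class can only be born or die at one of these finitely many radii.
\<close>

definition appearance :: "'a::euclidean_space set \<Rightarrow> real" where
  "appearance \<sigma> = Inf {r. (\<Inter>x\<in>\<sigma>. cball x r) \<noteq> {}}"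

lemma radii_up_closed:
  fixes \<sigma> :: "'a::euclidean_space set"
  assumes "(\<Inter>x\<in>\<sigma>. cball x r) \<noteq> {}" "r \<le> r'"
  shows "(\<Inter>x\<in>\<sigma>. cball x r') \<noteq> {}"
proof -
  have "(\<Inter>x\<in>\<sigma>. cball x r) \<subseteq> (\<Inter>x\<in>\<sigma>. cball x r')"
    using assms(2) by (auto simp: subset_cball)
  then show ?thesis using assms(1) by blast
qed

lemma radius_nonneg:
  fixes \<sigma> :: "'a::euclidean_space set"
  assumes "(\<Inter>x\<in>\<sigma>. cball x r) \<noteq> {}" "\<sigma> \<noteq> {}"
  shows "0 \<le> r"
proof -
  obtain x where "x \<in> \<sigma>" using assms by blast
  then have "cball x r \<noteq> {}" using assms(1) by blast
  then show ?thesis by simp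
qed

lemma appearance_bounds:
  fixes \<sigma> :: "'a::euclidean_space set"
  assumes "\<sigma> \<noteq> {}" "\<sigma> \<subseteq> cball 0 R"
  shows "0 \<le> appearance \<sigma>" "appearance \<sigma> \<le> R"
proof -
  let ?P = "{r. (\<Inter>x\<in>\<sigma>. cball x r) \<noteq> {}}"
  have "0 \<in> (\<Inter>x\<in>\<sigma>. cball x R)" using assms by (auto simp: dist_commute)
  then have R: "R \<in> ?P" by blast
  have nn: "\<And>r. r \<in> ?P \<Longrightarrow> 0 \<le> r" using radius_nonneg[of _ \<sigma>] assms(1) by blast
  show "0 \<le> appearance \<sigma>"
    unfolding appearance_def using R nn by (intro cInf_greatest) auto
  show "appearance \<sigma> \<le> R"
    unfolding appearance_def using R nn by (intro cInf_lower bdd_belowI[of _ 0]) auto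
qed

text \<open>
  The radii at which a simplex is present form an up-closed set. Just below \<open>b\<close> its membership is thus constant,
  and it agrees with membership at \<open>b\<close> unless \<open>b\<close> is the infimum of that set.
\<close>

lemma eventually_left_radius:
  fixes \<sigma> :: "'a::euclidean_space set"
  assumes "\<sigma> \<noteq> {}"
  shows "\<exists>v. (\<forall>\<^sub>F \<epsilon> in at_right 0. ((\<Inter>x\<in>\<sigma>. cball x (b - \<epsilon>)) \<noteq> {}) = v) \<and>
             (v \<longrightarrow> (\<Inter>x\<in>\<sigma>. cball x b) \<noteq> {}) \<and>
             (b \<noteq> appearance \<sigma> \<longrightarrow> v = ((\<Inter>x\<in>\<sigma>. cball x b) \<noteq> {}))"
proof -
  let ?P = "{r. (\<Inter>x\<in>\<sigma>. cball x r) \<noteq> {}}"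
  have bdd: "bdd_below ?P" using radius_nonneg[of _ \<sigma>] assms by (intro bdd_belowI[of _ 0]) auto
  show ?thesis
  proof (cases "\<exists>a\<in>?P. a < b")
    case True
    then obtain a where a: "a \<in> ?P" "a < b" by blast
    have "\<forall>\<^sub>F \<epsilon> in at_right 0. \<epsilon> < b - a"
      using a(2) by (intro eventually_at_rightI[of 0 "b - a"]) auto
    then have "\<forall>\<^sub>F \<epsilon> in at_right 0. ((\<Inter>x\<in>\<sigma>. cball x (b - \<epsilon>)) \<noteq> {}) = True"
      
    proof eventually_elim
      case (elim \<epsilon>)
      then show ?case using a(1) radii_up_closed[of a \<sigma> "b - \<epsilon>"] by simp
    qed
    moreover have "(\<Inter>x\<in>\<sigma>. cball x b) \<noteq> {}" using a radii_up_closed[of a \<sigma> b] by auto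
    ultimately show ?thesis by blast
  next
    case False
    have "\<forall>\<^sub>F \<epsilon>::real in at_right 0. 0 < \<epsilon>" by (rule eventually_at_right_less)
    then have *: "\<forall>\<^sub>F \<epsilon> in at_right 0. ((\<Inter>x\<in>\<sigma>. cball x (b - \<epsilon>)) \<noteq> {}) = False"
    proof eventually_elim
      case (elim \<epsilon>)
      then have "b - \<epsilon> < b" by simp
      then show ?case using False by blast
    qed
    moreover have "(\<Inter>x\<in>\<sigma>. cball x b) = {}" if "b \<noteq> appearance \<sigma>"
    proof (rule ccontr)
      assume "(\<Inter>x\<in>\<sigma>. cball x b) \<noteq> {}"
      then have "b \<in> ?P" by blast
      then have "appearance \<sigma> = b"
        unfolding appearance_def using False bdd
        by (intro cInf_eq_minimum) (auto simp: not_less)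
      then show False using that by simp
    qed
    ultimately show ?thesis by blast
  qed
qed

lemma eventually_left_cech:
  fixes X :: "'a::euclidean_space set"
  assumes "finite X"
  shows "\<exists>K. (\<forall>\<^sub>F \<epsilon> in at_right 0. simplices l X \<inter> cech_complex X (b - \<epsilon>) = K) \<and>
             K \<subseteq> simplices l X \<inter> cech_complex X b \<and>
             (b \<notin> appearance ` simplices l X \<longrightarrow> K = simplices l X \<inter> cech_complex X b)"
proof -
  have ne: "\<sigma> \<noteq> {}" if "\<sigma> \<in> simplices l X" for \<sigma> using that by (auto simp: simplices_def)
  define Q where "Q \<sigma> v \<longleftrightarrow>
             (\<forall>\<^sub>F \<epsilon> in at_right 0. ((\<Inter>x\<in>\<sigma>. cball x (b - \<epsilon>)) \<noteq> {}) = v) \<and>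
             (v \<longrightarrow> (\<Inter>x\<in>\<sigma>. cball x b) \<noteq> {}) \<and>
             (b \<noteq> appearance \<sigma> \<longrightarrow> v = ((\<Inter>x\<in>\<sigma>. cball x b) \<noteq> {}))"
    for \<sigma> :: "'a set" and v
  have "\<forall>\<sigma>\<in>simplices l X. \<exists>v. Q \<sigma> v"
    unfolding Q_def by (intro ballI eventually_left_radius ne)
  from bchoice[OF this] obtain v where v: "\<forall>\<sigma>\<in>simplices l X. Q \<sigma> (v \<sigma>)" ..
  have cech: "\<sigma> \<in> cech_complex X r \<longleftrightarrow> (\<Inter>x\<in>\<sigma>. cball x r) \<noteq> {}" if "\<sigma> \<in> simplices l X" for \<sigma> r
    using that by (auto simp: cech_complex_def simplices_def)
  have "\<forall>\<^sub>F \<epsilon> in at_right 0. \<forall>\<sigma>\<in>simplices l X. ((\<Inter>x\<in>\<sigma>. cball x (b - \<epsilon>)) \<noteq> {}) = v \<sigma>"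
    using finite_simplices[OF assms] v by (simp add: eventually_ball_finite_distrib Q_def)
  then have "\<forall>\<^sub>F \<epsilon> in at_right 0. simplices l X \<inter> cech_complex X (b - \<epsilon>) = {\<sigma> \<in> simplices l X. v \<sigma>}"
    by eventually_elim (auto simp: cech)
  moreover have "{\<sigma> \<in> simplices l X. v \<sigma>} \<subseteq> simplices l X \<inter> cech_complex X b"
    using v cech by (auto simp: Q_def)
  moreover have "{\<sigma> \<in> simplices l X. v \<sigma>} = simplices l X \<inter> cech_complex X b"
    if "b \<notin> appearance ` simplices l X"
    using v cech that by (auto simp: Q_def)
  ultimately show ?thesis by blast
qed

lemma chains_cech_eq: "chains l (cech_complex X r) = chains l (simplices l X \<inter> cech_complex X r)"
  unfolding chains_def simplices_def by (auto simp: cech_complex_def)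

lemma chains_mono: "K \<subseteq> K' \<Longrightarrow> chains l K \<subseteq> chains l K'"
  unfolding chains_def by blast

lemma chains_empty: "chains l {} = {0}"
  unfolding chains_def by auto

lemma cycles_cech_eq: "cycles X l (cech_complex X r) = cycles X l (simplices l X \<inter> cech_complex X r)"
  unfolding cycles_def chains_cech_eq[of l X r] ..

lemma boundaries_cech_eq:
  "boundaries X l (cech_complex X r) = boundaries X l (simplices (l + 1) X \<inter> cech_complex X r)"
  unfolding boundaries_def chains_cech_eq[of "l + 1" X r] ..

lemma persistent_betti_eq:
  fixes k :: "'k::field itself" and X :: "'a::euclidean_space set"
  assumes "finite X"
  shows "int (persistent_betti k l X r s) =
     int (chain.dim (cycles X l (cech_complex X r) :: ('a set \<Rightarrow>\<^sub>0 'k) set)) -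
     int (chain.dim (cycles X l (cech_complex X r) \<inter> boundaries X l (cech_complex X s)
            :: ('a set \<Rightarrow>\<^sub>0 'k) set))"
proof -
  have "chain.dim (cycles X l (cech_complex X r) \<inter> boundaries X l (cech_complex X s)
            :: ('a set \<Rightarrow>\<^sub>0 'k) set) \<le> chain.dim (cycles X l (cech_complex X r) :: ('a set \<Rightarrow>\<^sub>0 'k) set)"
    by (rule chain.dim_le_dim_of_subset[OF _ cycles_subset_span finite_unit_chains[OF assms]]) auto
  then show ?thesis
    unfolding persistent_betti_def Let_def by (simp add: of_nat_diff)
qed

text \<open>
  For the left limits \<open>Z'\<close> and \<open>B'\<close> of the cycles and boundaries, the dimensions of the cycle spaces cancel in
  the inclusion-exclusion formula, and the value that remains is \<open>dim U - dim (U1 + U2)\<close> for \<open>U = Z \<inter> B\<close>,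
  \<open>U1 = Z \<inter> B'\<close> and \<open>U2 = Z' \<inter> B\<close>. It is non-negative by submodularity of the dimension, so the
  description by which the multiplicity is defined does denote a natural number.
\<close>

lemma pd_mult_eq:
  fixes k :: "'k::field itself" and X :: "'a::euclidean_space set" and b d :: real and l :: nat
  defines "Z \<equiv> cycles X l (cech_complex X b) :: ('a set \<Rightarrow>\<^sub>0 'k) set"
    and "B \<equiv> boundaries X l (cech_complex X d) :: ('a set \<Rightarrow>\<^sub>0 'k) set"
  assumes fin: "finite X"
  obtains Z' B' :: "('a set \<Rightarrow>\<^sub>0 'k) set" where
    "\<forall>\<^sub>F \<epsilon> in at_right 0. cycles X l (cech_complex X (b - \<epsilon>)) = Z'"
    "\<forall>\<^sub>F \<epsilon> in at_right 0. boundaries X l (cech_complex X (d - \<epsilon>)) = B'"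
    "Z' \<subseteq> Z" "B' \<subseteq> B"
    "b \<notin> appearance ` simplices l X \<longrightarrow> Z' = Z"
    "d \<notin> appearance ` simplices (l + 1) X \<longrightarrow> B' = B"
    "int (pd_mult k l X b d) = int (chain.dim (Z \<inter> B)) + int (chain.dim (Z' \<inter> B'))
        - int (chain.dim (Z \<inter> B')) - int (chain.dim (Z' \<inter> B))"
proof -
  obtain Kb where "(\<forall>\<^sub>F \<epsilon> in at_right 0. simplices l X \<inter> cech_complex X (b - \<epsilon>) = Kb) \<and>
      Kb \<subseteq> simplices l X \<inter> cech_complex X b \<and>
      (b \<notin> appearance ` simplices l X \<longrightarrow> Kb = simplices l X \<inter> cech_complex X b)"
    using eventually_left_cech[OF fin, of "l" b] ..
  then have Kb: "\<forall>\<^sub>F \<epsilon> in at_right 0. simplices l X \<inter> cech_complex X (b - \<epsilon>) = Kb"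
    "Kb \<subseteq> simplices l X \<inter> cech_complex X b"
    "b \<notin> appearance ` simplices l X \<Longrightarrow> Kb = simplices l X \<inter> cech_complex X b"
    by simp_all
  obtain Kd where "(\<forall>\<^sub>F \<epsilon> in at_right 0. simplices (l + 1) X \<inter> cech_complex X (d - \<epsilon>) = Kd) \<and>
      Kd \<subseteq> simplices (l + 1) X \<inter> cech_complex X d \<and>
      (d \<notin> appearance ` simplices (l + 1) X \<longrightarrow> Kd = simplices (l + 1) X \<inter> cech_complex X d)"
    using eventually_left_cech[OF fin, of "l + 1" d] ..
  then have Kd: "\<forall>\<^sub>F \<epsilon> in at_right 0. simplices (l + 1) X \<inter> cech_complex X (d - \<epsilon>) = Kd"
    "Kd \<subseteq> simplices (l + 1) X \<inter> cech_complex X d"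
    "d \<notin> appearance ` simplices (l + 1) X \<Longrightarrow> Kd = simplices (l + 1) X \<inter> cech_complex X d"
    by simp_all
  define Z' :: "('a set \<Rightarrow>\<^sub>0 'k) set" where "Z' = cycles X l Kb"
  define B' :: "('a set \<Rightarrow>\<^sub>0 'k) set" where "B' = boundaries X l Kd"
  have evZ: "\<forall>\<^sub>F \<epsilon> in at_right 0. cycles X l (cech_complex X (b - \<epsilon>)) = Z'"
    using Kb(1) by eventually_elim (simp add: Z'_def cycles_cech_eq)
  have evB: "\<forall>\<^sub>F \<epsilon> in at_right 0. boundaries X l (cech_complex X (d - \<epsilon>)) = B'"
    using Kd(1) by eventually_elim (simp add: B'_def boundaries_cech_eq)
  have ZZ: "Z' \<subseteq> Z"
    unfolding Z'_def Z_def cycles_cech_eq[of X l b] using chains_mono[OF Kb(2), of l]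
    unfolding cycles_def by blast
  have BB: "B' \<subseteq> B"
    unfolding B'_def B_def boundaries_cech_eq[of X l d] using chains_mono[OF Kd(2), of "l + 1"]
    unfolding boundaries_def by blast
  have Zeq: "b \<notin> appearance ` simplices l X \<Longrightarrow> Z' = Z"
    unfolding Z'_def Z_def cycles_cech_eq[of X l b] using Kb(3) by simp
  have Beq: "d \<notin> appearance ` simplices (l + 1) X \<Longrightarrow> B' = B"
    unfolding B'_def B_def boundaries_cech_eq[of X l d] using Kd(3) by simp
  let ?w = "int (chain.dim (Z \<inter> B)) + int (chain.dim (Z' \<inter> B'))
        - int (chain.dim (Z \<inter> B')) - int (chain.dim (Z' \<inter> B))"
  have ev: "\<forall>\<^sub>F \<epsilon> in at_right 0.
       (int (persistent_betti k l X b (d - \<epsilon>)) - int (persistent_betti k l X b d))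
     - (int (persistent_betti k l X (b - \<epsilon>) (d - \<epsilon>)) - int (persistent_betti k l X (b - \<epsilon>) d)) = ?w"
    using evZ evB
    by eventually_elim (simp add: persistent_betti_eq[OF fin] flip: Z_def B_def)
  have "Z \<subseteq> chain.span (unit_chains l X)"
    unfolding Z_def by (rule cycles_subset_span)
  then have "chain.dim (Z \<inter> B') + chain.dim (Z' \<inter> B) \<le> chain.dim (Z \<inter> B) + chain.dim ((Z \<inter> B') \<inter> (Z' \<inter> B))"
    using ZZ BB
    by (intro chain.dim_submodular[OF _ _ _ _ finite_unit_chains[OF fin]])
       (auto simp: Z_def B_def Z'_def B'_def intro!: chain.subspace_inter subspace_cycles subspace_boundaries)
  moreover have "(Z \<inter> B') \<inter> (Z' \<inter> B) = Z' \<inter> B'" using ZZ BB by blast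
  ultimately have "0 \<le> ?w" by simp
  then obtain m where m: "int m = ?w" using zero_le_imp_eq_int by metis
  have mult: "pd_mult k l X b d = m"
    unfolding pd_mult_def
  proof (rule the_equality)
    show "\<forall>\<^sub>F \<epsilon> in at_right 0. int m = 
       (int (persistent_betti k l X b (d - \<epsilon>)) - int (persistent_betti k l X b d))
     - (int (persistent_betti k l X (b - \<epsilon>) (d - \<epsilon>)) - int (persistent_betti k l X (b - \<epsilon>) d))"
      using ev by eventually_elim (simp add: m)
  next
    fix m'
    assume "\<forall>\<^sub>F \<epsilon> in at_right 0. int m' = 
       (int (persistent_betti k l X b (d - \<epsilon>)) - int (persistent_betti k l X b d))
     - (int (persistent_betti k l X (b - \<epsilon>) (d - \<epsilon>)) - int (persistent_betti k l X (b - \<epsilon>) d))"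
    with ev have "\<forall>\<^sub>F \<epsilon>::real in at_right 0. int m' = int m"
      by eventually_elim (use m in linarith)
    then show "m' = m" by simp
  qed
  have final: "int (pd_mult k l X b d) = ?w"
    by (simp only: mult m)
  show thesis
    by (rule that[OF evZ evB ZZ BB _ _ final]) (use Zeq Beq in blast)+
qed

lemma pd_mult_nonzeroD:
  fixes X :: "'a::euclidean_space set" and k :: "'k::field itself"
  assumes "finite X" "pd_mult k l X b d \<noteq> 0"
  shows "b \<in> appearance ` simplices l X" "d \<in> appearance ` simplices (l + 1) X"
proof -
  let ?Z = "cycles X l (cech_complex X b) :: ('a set \<Rightarrow>\<^sub>0 'k) set"
  let ?B = "boundaries X l (cech_complex X d) :: ('a set \<Rightarrow>\<^sub>0 'k) set"
  obtain Z' B' :: "('a set \<Rightarrow>\<^sub>0 'k) set" where ZB: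
    "\<forall>\<^sub>F \<epsilon> in at_right 0. cycles X l (cech_complex X (b - \<epsilon>)) = Z'"
    "\<forall>\<^sub>F \<epsilon> in at_right 0. boundaries X l (cech_complex X (d - \<epsilon>)) = B'"
    "Z' \<subseteq> ?Z" "B' \<subseteq> ?B"
    "b \<notin> appearance ` simplices l X \<longrightarrow> Z' = ?Z"
    "d \<notin> appearance ` simplices (l + 1) X \<longrightarrow> B' = ?B"
    "int (pd_mult k l X b d) = int (chain.dim (?Z \<inter> ?B)) + int (chain.dim (Z' \<inter> B'))
        - int (chain.dim (?Z \<inter> B')) - int (chain.dim (Z' \<inter> ?B))"
    by (rule pd_mult_eq[OF assms(1), of l b d k])
  show "b \<in> appearance ` simplices l X"
    using ZB(5,7) assms(2) by auto
  show "d \<in> appearance ` simplices (l + 1) X"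
    using ZB(6,7) assms(2) by auto
qed

lemma pd_mult_le:
  fixes X :: "'a::euclidean_space set" and k :: "'k::field itself"
  assumes "finite X"
  shows "pd_mult k l X b d \<le> card X ^ (l + 1)"
proof -
  let ?Z = "cycles X l (cech_complex X b) :: ('a set \<Rightarrow>\<^sub>0 'k) set"
  let ?B = "boundaries X l (cech_complex X d) :: ('a set \<Rightarrow>\<^sub>0 'k) set"
  obtain Z' B' :: "('a set \<Rightarrow>\<^sub>0 'k) set" where ZB: 
    "\<forall>\<^sub>F \<epsilon> in at_right 0. cycles X l (cech_complex X (b - \<epsilon>)) = Z'"
    "\<forall>\<^sub>F \<epsilon> in at_right 0. boundaries X l (cech_complex X (d - \<epsilon>)) = B'"
    "Z' \<subseteq> ?Z" "B' \<subseteq> ?B"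
    "b \<notin> appearance ` simplices l X \<longrightarrow> Z' = ?Z"
    "d \<notin> appearance ` simplices (l + 1) X \<longrightarrow> B' = ?B"
    "int (pd_mult k l X b d) = int (chain.dim (?Z \<inter> ?B)) + int (chain.dim (Z' \<inter> B'))
        - int (chain.dim (?Z \<inter> B')) - int (chain.dim (Z' \<inter> ?B))"
    by (rule pd_mult_eq[OF assms, of l b d k])
  have Zsp: "?Z \<subseteq> chain.span (unit_chains l X)" by (rule cycles_subset_span)
  then have "chain.dim (Z' \<inter> B') \<le> chain.dim (?Z \<inter> B')"
    using ZB by (intro chain.dim_le_dim_of_subset[OF _ _ finite_unit_chains[OF assms]]) auto
  then have "pd_mult k l X b d \<le> chain.dim (?Z \<inter> ?B)" using ZB(7) by linarith
  also have "\<dots> \<le> card (unit_chains l X :: ('a set \<Rightarrow>\<^sub>0 'k) set)"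
    using Zsp by (intro chain.dim_le_card finite_unit_chains assms) auto
  also have "\<dots> \<le> card (simplices l X)"
    unfolding unit_chains_def by (rule card_image_le[OF finite_simplices[OF assms]])
  also have "\<dots> \<le> card X ^ (l + 1)" by (rule card_simplices_le[OF assms])
  finally show ?thesis .
qed

lemma count_Dgm:
  fixes X :: "'a::euclidean_space set"
  assumes "finite X"
  shows "count (Dgm k l X) (b, d) = (if b < d then pd_mult k l X b d else 0)"
proof -
  let ?f = "\<lambda>(b, d). if (b, d) \<in> Delta then pd_mult k l X b d else 0"
  have "{x. 0 < ?f x} \<subseteq> appearance ` simplices l X \<times> appearance ` simplices (l + 1) X"
    using pd_mult_nonzeroD[OF assms] by (auto split: if_splits)
  then have "finite {x. 0 < ?f x}"
    by (rule finite_subset) (use assms in \<open>simp add: finite_simplices\<close>)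
  then show ?thesis
    unfolding Dgm_def by (subst count_Abs_multiset) (auto simp: Delta_def)
qed

lemma set_mset_Dgm:
  fixes X :: "'a::euclidean_space set"
  assumes "finite X"
  shows "set_mset (Dgm k l X) \<subseteq> Delta \<inter> (appearance ` simplices l X \<times> appearance ` simplices (l + 1) X)"
proof
  fix x assume "x \<in> set_mset (Dgm k l X)"
  then have "0 < count (Dgm k l X) (fst x, snd x)" by simp
  then show "x \<in> Delta \<inter> (appearance ` simplices l X \<times> appearance ` simplices (l + 1) X)"
    unfolding count_Dgm[OF assms] using pd_mult_nonzeroD[OF assms, of k l "fst x" "snd x"]
    by (cases x) (auto simp: Delta_def split: if_splits)
qed

text \<open>
  The support of the diagram lies in the product of the appearance radii of \<open>l\<close>-simplices and of
  \<open>(l+1)\<close>-simplices, and each multiplicity is at most the number of \<open>l\<close>-simplices. The exponent is the sum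
  of \<open>l + 1\<close>, \<open>l + 2\<close> and \<open>l + 1\<close>; any polynomial bound is good enough to be integrated with the moments of a point
  process.
\<close>

lemma size_Dgm_le:
  fixes X :: "'a::euclidean_space set"
  assumes "finite X"
  shows "size (Dgm k l X) \<le> card X ^ (3 * l + 4)"
proof -
  let ?S = "appearance ` simplices l X \<times> appearance ` simplices (l + 1) X"
  have fin: "finite ?S" using assms by (simp add: finite_simplices)
  have "card ?S \<le> card (simplices l X) * card (simplices (l + 1) X)"
    unfolding card_cartesian_product using assms
    by (intro mult_mono card_image_le finite_simplices) auto
  also have "\<dots> \<le> card X ^ (l + 1) * card X ^ (l + 2)"
    using card_simplices_le[OF assms, of l] card_simplices_le[OF assms, of "l + 1"] by (intro mult_mono) auto
  finally have S: "card ?S \<le> card X ^ (l + 1) * card X ^ (l + 2)" .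
  have "size (Dgm k l X) = (\<Sum>x\<in>set_mset (Dgm k l X). count (Dgm k l X) x)"
    by (rule size_multiset_overloaded_eq)
  also have "\<dots> \<le> (\<Sum>x\<in>set_mset (Dgm k l X). card X ^ (l + 1))"
    using pd_mult_le[OF assms] by (intro sum_mono) (auto simp: count_Dgm[OF assms])
  also have "\<dots> \<le> card ?S * card X ^ (l + 1)"
    using card_mono[OF fin, of "set_mset (Dgm k l X)"] set_mset_Dgm[OF assms, of k l] by simp
  also have "\<dots> \<le> card X ^ (l + 1) * card X ^ (l + 2) * card X ^ (l + 1)"
    using S by (rule mult_right_mono) simp
  also have "\<dots> = card X ^ (3 * l + 4)" 
  proof -
    have "l + 1 + (l + 2) + (l + 1) = 3 * l + 4" by simp
    then show ?thesis by (simp only: power_add[symmetric])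
  qed
  finally show ?thesis .
qed

lemma set_mset_pd_union:
  fixes X :: "'a::euclidean_space set"
  assumes "finite X" "X \<subseteq> cball 0 R"
  shows "set_mset (pd_union k X) \<subseteq> {(b, d). b < d \<and> 0 \<le> b \<and> d \<le> R}"
proof -
  have "appearance \<sigma> \<in> {0..R}" if "\<sigma> \<in> simplices l X" for l \<sigma>
    using appearance_bounds[of \<sigma> R] that assms by (force simp: simplices_def)
  then have "set_mset (Dgm k l X) \<subseteq> {(b, d). b < d \<and> 0 \<le> b \<and> d \<le> R}" for l
    using set_mset_Dgm[OF assms(1), of k l] by (fastforce simp: Delta_def)
  moreover have "set_mset (pd_union k X) = (\<Union>l<DIM('a). set_mset (Dgm k l X))"
    unfolding pd_union_def by (simp add: set_mset_sum)
  ultimately show ?thesis by blast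
qed

lemma size_pd_union_le:
  fixes X :: "'a::euclidean_space set"
  assumes "finite X"
  shows "size (pd_union k X) \<le> DIM('a) * card X ^ (3 * DIM('a) + 1)"
proof -
  have "size (pd_union k X) = (\<Sum>l<DIM('a). size (Dgm k l X))"
    unfolding pd_union_def by simp
  also have "\<dots> \<le> (\<Sum>l<DIM('a). card X ^ (3 * DIM('a) + 1))"
  proof (rule sum_mono)
    fix l assume l: "l \<in> {..<DIM('a)}"
    have "card X ^ (3 * l + 4) \<le> card X ^ (3 * DIM('a) + 1)"
    proof (cases "card X = 0")
      case False
      then show ?thesis using l by (intro power_increasing) auto
    qed (simp add: power_0_left)
    then show "size (Dgm k l X) \<le> card X ^ (3 * DIM('a) + 1)"
      using size_Dgm_le[OF assms, of k l] by simp
  qed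
  finally show ?thesis by simp
qed

lemma cball_inter_cball_nonempty_iff:
  fixes x y :: "'a::euclidean_space"
  shows "cball x r \<inter> cball y r \<noteq> {} \<longleftrightarrow> dist x y \<le> 2 * r"
proof
  assume "cball x r \<inter> cball y r \<noteq> {}"
  then obtain z where "dist x z \<le> r" "dist y z \<le> r" by auto
  then show "dist x y \<le> 2 * r" using dist_triangle2[of x y z] by simp
next
  assume *: "dist x y \<le> 2 * r"
  have "midpoint x y \<in> cball x r \<inter> cball y r"
    using * dist_midpoint[of x y] by (simp add: dist_commute field_simps)
  then show "cball x r \<inter> cball y r \<noteq> {}" by blast
qed

text \<open>
  The boundary of an edge is a non-zero chain on its two end points, whatever the signs of the orientation.
\<close>

lemma edge_boundary:
  fixes K :: "'a set set"
  assumes "x \<noteq> y" "{x, y} \<in> K"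
  obtains c :: "'a set \<Rightarrow>\<^sub>0 'k::field"
  where "c \<in> boundaries X 0 K" "c \<noteq> 0" "Poly_Mapping.keys c \<subseteq> {{x}, {y}}"
proof -
  define e :: "'a set \<Rightarrow>\<^sub>0 'k" where "e = Poly_Mapping.single {x, y} 1"
  define s where "s v = (-1 :: 'k) ^ card {w \<in> {x, y}. to_nat_on X w < to_nat_on X v}" for v
  have "{x, y} - {x} = {y}" "{x, y} - {y} = {x}" "card {x, y} = 2" using assms by auto
  then have "simplex_boundary X {x, y} = Poly_Mapping.single {y} (s x) + Poly_Mapping.single {x} (s y)"
    unfolding simplex_boundary_def s_def[symmetric] using assms by simp
  then have bd: "boundary X e = Poly_Mapping.single {y} (s x) + Poly_Mapping.single {x} (s y)"
    by (simp add: boundary_def e_def)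
  have "e \<in> chains (0 + 1) K"
    using assms by (simp add: e_def chains_def)
  then have in_B: "boundary X e \<in> boundaries X 0 K"
    unfolding boundaries_def by (rule imageI)
  have "{x} \<noteq> {y}" using assms by simp
  then have "Poly_Mapping.lookup (boundary X e) {y} = s x"
    unfolding bd lookup_add lookup_single by (simp add: when_def)
  moreover have "s x \<noteq> 0" by (simp add: s_def)
  ultimately have nz: "boundary X e \<noteq> 0" by auto
  have keys: "Poly_Mapping.keys (boundary X e) \<subseteq> {{x}, {y}}"
    unfolding bd using Poly_Mapping.keys_add[of "Poly_Mapping.single {y} (s x)" "Poly_Mapping.single {x} (s y)"]
    by (auto split: if_splits)
  show thesis by (rule that[OF in_B nz keys])
qed

lemma zero_chain_is_cycle:
  fixes c :: "'a set \<Rightarrow>\<^sub>0 'k::field"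
  assumes "\<And>\<sigma>. \<sigma> \<in> Poly_Mapping.keys c \<Longrightarrow> \<sigma> \<in> K \<and> (\<exists>v. \<sigma> = {v})"
  shows "c \<in> cycles X 0 K"
proof -
  have "simplex_boundary X \<sigma> = (0 :: 'a set \<Rightarrow>\<^sub>0 'k)" if "\<sigma> \<in> Poly_Mapping.keys c" for \<sigma>
    using assms[OF that] by (auto simp: simplex_boundary_def)
  then have "boundary X c = 0" by (simp add: boundary_def)
  then show ?thesis using assms by (fastforce simp: cycles_def chains_def)
qed

text \<open>
  Two components, born at radius 0, merge at radius \<open>d\<close>, half the minimal distance of two points. There are
  neither vertices below radius 0 nor edges below radius \<open>d\<close>, so the multiplicity of \<open>(0, d)\<close>
  reduces to the dimension of \<open>Z \<inter> B\<close>, which contains the boundary of a shortest edge.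
\<close>

lemma pd_union_nonempty:
  fixes X :: "'a::euclidean_space set" and k :: "'k::field itself"
  assumes fin: "finite X" and card: "2 \<le> card X"
  shows "pd_union k X \<noteq> {#}"
proof -
  let ?P = "{p \<in> X \<times> X. fst p \<noteq> snd p}"
  obtain u v where "u \<in> X" "v \<in> X" "u \<noteq> v"
    using card card_le_Suc0_iff_eq[OF fin] by auto
  then have P: "finite ?P" "?P \<noteq> {}" using fin by auto
  let ?D = "(\<lambda>p. dist (fst p) (snd p)) ` ?P"
  have "Min ?D \<in> ?D" using P by (intro Min_in) auto
  then obtain p where "p \<in> ?P" "dist (fst p) (snd p) = Min ?D" by auto
  then have p: "p \<in> ?P" "\<And>p'. p' \<in> ?P \<Longrightarrow> dist (fst p) (snd p) \<le> dist (fst p') (snd p')"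
    using P(1) by (auto intro!: Min_le)
  define x y where "x = fst p" and "y = snd p"
  have xy: "x \<in> X" "y \<in> X" "x \<noteq> y" using p by (auto simp: x_def y_def)
  have min: "dist x y \<le> dist x' y'" if "x' \<in> X" "y' \<in> X" "x' \<noteq> y'" for x' y'
    using p(2)[of "(x', y')"] that by (auto simp: x_def y_def)
  define d where "d = dist x y / 2"
  have d: "0 < d" using xy by (simp add: d_def)
  let ?Z = "cycles X 0 (cech_complex X 0) :: ('a set \<Rightarrow>\<^sub>0 'k) set"
  let ?B = "boundaries X 0 (cech_complex X d) :: ('a set \<Rightarrow>\<^sub>0 'k) set"
  obtain Z' B' :: "('a set \<Rightarrow>\<^sub>0 'k) set" where ZB:
    "\<forall>\<^sub>F \<epsilon> in at_right 0. cycles X 0 (cech_complex X (0 - \<epsilon>)) = Z'"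
    "\<forall>\<^sub>F \<epsilon> in at_right 0. boundaries X 0 (cech_complex X (d - \<epsilon>)) = B'"
    "Z' \<subseteq> ?Z" "B' \<subseteq> ?B"
    "0 \<notin> appearance ` simplices 0 X \<longrightarrow> Z' = ?Z"
    "d \<notin> appearance ` simplices (0 + 1) X \<longrightarrow> B' = ?B"
    "int (pd_mult k 0 X 0 d) = int (chain.dim (?Z \<inter> ?B)) + int (chain.dim (Z' \<inter> B'))
        - int (chain.dim (?Z \<inter> B')) - int (chain.dim (Z' \<inter> ?B))"
    by (rule pd_mult_eq[OF fin, of 0 0 d k])
  have novert: "cycles X 0 (cech_complex X r) = ({0} :: ('a set \<Rightarrow>\<^sub>0 'k) set)" if "r < 0" for r
  proof -
    have empty: "simplices 0 X \<inter> cech_complex X r = {}"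
    proof -
      have False if \<sigma>: "\<sigma> \<in> simplices 0 X" "\<sigma> \<in> cech_complex X r" for \<sigma>
      proof -
        have "\<sigma> \<noteq> {}" using \<sigma> by (auto simp: simplices_def)
        then show False using radius_nonneg[of r \<sigma>] \<sigma> \<open>r < 0\<close> by (auto simp: cech_complex_def)
      qed
      then show ?thesis by blast
    qed
    show ?thesis unfolding cycles_cech_eq[of X 0 r] unfolding empty cycles_def chains_empty by auto
  qed
  have noedge: "boundaries X 0 (cech_complex X r) = ({0} :: ('a set \<Rightarrow>\<^sub>0 'k) set)" if "r < d" for r
  proof -
    have empty: "simplices (0 + 1) X \<inter> cech_complex X r = {}"
    proof -
      have False if \<sigma>: "\<sigma> \<in> simplices (0 + 1) X" "\<sigma> \<in> cech_complex X r" for \<sigma>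
      proof -
        have "card \<sigma> = 2" "\<sigma> \<subseteq> X" using \<sigma> by (auto simp: simplices_def)
        then obtain x' y' where s: "\<sigma> = {x', y'}" "x' \<noteq> y'" by (auto simp: card_2_iff)
        then have "cball x' r \<inter> cball y' r \<noteq> {}" using \<sigma>(2) by (simp add: cech_complex_def)
        then have "dist x' y' \<le> 2 * r" by (simp only: cball_inter_cball_nonempty_iff)
        moreover have "dist x y \<le> dist x' y'" using min s \<open>\<sigma> \<subseteq> X\<close> by auto
        ultimately show False using \<open>r < d\<close> by (simp add: d_def)
      qed
      then show ?thesis by blast
    qed
    show ?thesis unfolding boundaries_cech_eq[of X 0 r] unfolding empty boundaries_def chains_empty by simp
  qed
  have "\<forall>\<^sub>F \<epsilon>::real in at_right 0. 0 < \<epsilon>" by (rule eventually_at_right_less)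
  with ZB(1) have "\<forall>\<^sub>F \<epsilon>::real in at_right 0. Z' = {0}"
  proof eventually_elim
    case (elim \<epsilon>)
    then show ?case using novert[of "0 - \<epsilon>"] by simp
  qed
  then have Z': "Z' = {0}" by simp
  have "\<forall>\<^sub>F \<epsilon>::real in at_right 0. 0 < \<epsilon>" by (rule eventually_at_right_less)
  with ZB(2) have "\<forall>\<^sub>F \<epsilon>::real in at_right 0. B' = {0}"
  proof eventually_elim
    case (elim \<epsilon>)
    then show ?case using noedge[of "d - \<epsilon>"] by simp
  qed
  then have B': "B' = {0}" by simp
  have "cball x d \<inter> cball y d \<noteq> {}"
    unfolding cball_inter_cball_nonempty_iff d_def by simp
  then have "{x, y} \<in> cech_complex X d" using xy by (simp add: cech_complex_def)
  then obtain c :: "'a set \<Rightarrow>\<^sub>0 'k" where c: "c \<in> boundaries X 0 (cech_complex X d)" "c \<noteq> 0"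
    "Poly_Mapping.keys c \<subseteq> {{x}, {y}}"
    by (rule edge_boundary[OF xy(3)])
  have "{z} \<in> cech_complex X 0" if "z \<in> X" for z
    using that by (simp add: cech_complex_def)
  then have "c \<in> ?Z"
    using c(3) xy by (intro zero_chain_is_cycle) auto
  then have "0 < chain.dim (?Z \<inter> ?B)"
    using c cycles_subset_span[of X 0 0]
    by (intro chain.dim_pos_of_nonzero[OF _ _ _ finite_unit_chains[OF fin]]) auto
  moreover have "?Z \<inter> B' \<subseteq> {0}" "Z' \<inter> ?B \<subseteq> {0}" using Z' B' by simp_all
  then have "chain.dim (?Z \<inter> B') = 0" "chain.dim (Z' \<inter> ?B) = 0"
    by (simp_all only: chain.dim_trivial)
  ultimately have "0 < pd_mult k 0 X 0 d" using ZB(7) by linarith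
  then have "(0, d) \<in># Dgm k 0 X"
    using d unfolding count_greater_zero_iff[symmetric] count_Dgm[OF fin] by simp
  moreover have "set_mset (pd_union k X) = (\<Union>l<DIM('a). set_mset (Dgm k l X))"
    unfolding pd_union_def by (simp add: set_mset_sum)
  ultimately show ?thesis by force
qed

section \<open>Finite measures on the half-plane above the diagonal\<close>

lemma sets_borel_Delta [measurable]: "Delta \<in> sets borel"
proof -
  have "Delta = {x. fst x < snd x}" by (auto simp: Delta_def)
  moreover have "open {x :: real \<times> real. fst x < snd x}"
    by (intro open_Collect_less continuous_intros)
  ultimately show ?thesis by simp
qed

lemma sets_restrict_Delta: "B \<in> sets (restrict_space borel Delta) \<longleftrightarrow> B \<in> sets borel \<and> B \<subseteq> Delta"
  by (subst sets_restrict_space_iff) auto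

lemma out_of_bounds_measurable:
  "{x \<in> Delta. \<not> (0 \<le> fst x \<and> snd x \<le> R)} \<in> sets (restrict_space borel Delta)"
proof -
  have "{x :: real \<times> real. 0 \<le> fst x \<and> snd x \<le> R} \<in> sets borel"
    by (intro borel_closed closed_Collect_conj closed_Collect_le continuous_intros)
  then show ?thesis
    using sets_borel_Delta sets.Diff[of Delta borel "{x :: real \<times> real. 0 \<le> fst x \<and> snd x \<le> R}"]
    by (simp add: sets_restrict_Delta set_diff_eq)
qed

lemma sigma_algebra_Delta: "sigma_algebra Delta (sets (restrict_space borel Delta))"
  using sets.sigma_algebra_axioms[of "restrict_space borel Delta"] by (simp add: space_restrict_space)

lemma sets_measure_of_Delta:
  "sets (measure_of Delta (sets (restrict_space borel Delta)) f) = sets (restrict_space borel Delta)"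
  by (simp add: sigma_algebra.sets_measure_of_eq[OF sigma_algebra_Delta])

lemma sets_diagram_measure: "sets (diagram_measure D) = sets (restrict_space borel Delta)"
  unfolding diagram_measure_def by (rule sets_measure_of_Delta)

lemma emeasure_diagram_measure:
  assumes "B \<in> sets (restrict_space borel Delta)"
  shows "emeasure (diagram_measure D) B = of_nat (size (filter_mset (\<lambda>x. x \<in> B) D))"
proof -
  let ?S = "sets (restrict_space borel Delta)"
  let ?m = "\<lambda>D B. of_nat (size (filter_mset (\<lambda>x. x \<in> B) D)) :: ennreal"
  have "countably_additive ?S (?m D)"
  proof (induction D)
    case empty
    then show ?case by (simp add: countably_additive_def)
  next
    case (add x D)
    show ?case
      unfolding countably_additive_def
    proof (intro allI impI)
      fix F :: "nat \<Rightarrow> (real \<times> real) set"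
      assume F: "range F \<subseteq> ?S" "disjoint_family F" "(\<Union>i. F i) \<in> ?S"
      have step: "?m (add_mset x D) B = indicator B x + ?m D B" for B
        by (simp add: indicator_def)
      have "suminf (\<lambda>i. indicator (F i) x) = (indicator (\<Union>(range F)) x :: ennreal)"
        by (rule suminf_indicator[OF F(2)])
      moreover have "suminf (\<lambda>i. ?m D (F i)) = ?m D (\<Union>i. F i)"
        using add F by (simp add: countably_additive_def)
      ultimately show "suminf (\<lambda>i. ?m (add_mset x D) (F i)) = ?m (add_mset x D) (\<Union>i. F i)"
        unfolding step by (subst suminf_add[symmetric]) auto
    qed
  qed
  moreover have "positive ?S (?m D)" by (simp add: positive_def)
  ultimately show ?thesis
    unfolding diagram_measure_def
    using emeasure_measure_of_sigma[OF sigma_algebra_Delta _ _ assms] by blast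
qed

lemma max_death_diagram_measure:
  assumes "set_mset D \<subseteq> Delta"
  shows "max_death (diagram_measure D) = Max (snd ` set_mset D)"
proof -
  have "{x \<in> Delta. emeasure (diagram_measure D) {x} > 0} = set_mset D"
  proof -
    have "emeasure (diagram_measure D) {x} > 0 \<longleftrightarrow> x \<in># D" if "x \<in> Delta" for x
    proof -
      have "{x} \<in> sets (restrict_space borel Delta)"
        using that by (simp add: sets_restrict_Delta)
      then have "emeasure (diagram_measure D) {x} = of_nat (size (filter_mset (\<lambda>y. y \<in> {x}) D))"
        by (rule emeasure_diagram_measure)
      moreover have "filter_mset (\<lambda>y. y \<in> {x}) D = replicate_mset (count D x) x"
        by (simp add: filter_eq_replicate_mset)
      ultimately show ?thesis by simp
    qed
    then show ?thesis using assms by blast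
  qed
  then show ?thesis by (simp add: max_death_def)
qed

text \<open>
  The common properties of the diagram measure of a finite set inside a ball of radius \<open>R\<close> and of the
  expectation of such measures. The bounds make the moments of persistence and death finite, and births at non-negative radii
  make the deaths positive.
\<close>

locale bounded_diagram =
  fixes \<mu> :: "(real \<times> real) measure" and R :: real
  assumes sets_eq: "sets \<mu> = sets (restrict_space borel Delta)"
    and finite_Delta: "emeasure \<mu> Delta < \<infinity>"
    and AE_bounds: "AE x in \<mu>. 0 \<le> fst x \<and> snd x \<le> R"
begin

lemma space_eq: "space \<mu> = Delta"
  using sets_eq_imp_space_eq[OF sets_eq] by (simp add: space_restrict_space)

sublocale finite_measure \<mu>
  by (rule finite_measureI) (use finite_Delta space_eq in auto)

lemma measurable_eq: "measurable \<mu> N = measurable (restrict_space borel Delta) N"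
  by (rule measurable_cong_sets[OF sets_eq refl])

lemma measurable_fst' [measurable]: "fst \<in> borel_measurable \<mu>"
  and measurable_snd' [measurable]: "snd \<in> borel_measurable \<mu>"
  unfolding measurable_eq by (intro measurable_restrict_space1; simp add: borel_prod[symmetric])+

lemma measurable_pers [measurable]: "pers \<in> borel_measurable \<mu>"
  unfolding pers_def[abs_def] by measurable

lemma AE_pers: "AE x in \<mu>. 0 < pers x \<and> pers x \<le> R \<and> 0 < snd x \<and> snd x \<le> R"
  using AE_bounds AE_space by eventually_elim (auto simp: space_eq Delta_def pers_def)

lemma not_AE_False: "emeasure \<mu> Delta \<noteq> 0 \<Longrightarrow> \<not> (AE x in \<mu>. False)"
  using AE_iff_measurable[of Delta \<mu> "\<lambda>_. False"] sets.top[of \<mu>] by (simp add: space_eq)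

lemma integrable_pers_powr: "0 < q \<Longrightarrow> integrable \<mu> (\<lambda>x. pers x powr q)"
proof (rule integrable_const_bound[where B = "R powr q"])
  assume "0 < q"
  show "AE x in \<mu>. norm (pers x powr q) \<le> R powr q"
    using AE_pers by eventually_elim (use \<open>0 < q\<close> in \<open>auto intro!: powr_mono2\<close>)
qed measurable

lemma integrable_death_powr: "0 < q \<Longrightarrow> integrable \<mu> (\<lambda>x. snd x powr q)"
proof (rule integrable_const_bound[where B = "R powr q"])
  assume "0 < q"
  show "AE x in \<mu>. norm (snd x powr q) \<le> R powr q"
    using AE_pers by eventually_elim (use \<open>0 < q\<close> in \<open>auto intro!: powr_mono2\<close>)
qed measurable

lemma pers_moment_pos:
  assumes q: "0 < q" and nz: "emeasure \<mu> Delta \<noteq> 0"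
  shows "0 < (\<integral>x. pers x powr q \<partial>\<mu>)"
proof -
  have "(\<integral>x. pers x powr q \<partial>\<mu>) \<noteq> 0"
  proof
    assume "(\<integral>x. pers x powr q \<partial>\<mu>) = 0"
    then have "AE x in \<mu>. pers x powr q = 0"
      using integral_nonneg_eq_0_iff_AE[OF integrable_pers_powr[OF q]] by simp
    with AE_pers have "AE x in \<mu>. False" by eventually_elim auto
    then show False using not_AE_False[OF nz] by blast
  qed
  moreover have "0 \<le> (\<integral>x. pers x powr q \<partial>\<mu>)" by simp
  ultimately show ?thesis by linarith
qed

text \<open>
  The normalisation of \<open>mean_pers\<close> by the number of points cancels in this product. It is the reason why the packing
  inequality becomes linear in the measure and can be integrated.
\<close>

lemma number_times_mean_pers:
  assumes q: "0 < q" and nz: "emeasure \<mu> Delta \<noteq> 0"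
  shows "0 < pd_number \<mu>" "pd_number \<mu> * mean_pers q \<mu> powr q = (\<integral>x. pers x powr q \<partial>\<mu>)"
proof -
  have "emeasure \<mu> Delta = ennreal (pd_number \<mu>)"
    unfolding pd_number_def by (rule emeasure_eq_measure)
  then show N: "0 < pd_number \<mu>" using nz by (cases "0 < pd_number \<mu>") (auto simp: ennreal_neg)
  show "pd_number \<mu> * mean_pers q \<mu> powr q = (\<integral>x. pers x powr q \<partial>\<mu>)"
    using q N pers_moment_pos[OF q nz] by (simp add: mean_pers_def powr_powr)
qed

text \<open>
  The norms in \<open>L\<^sup>p\<close> of a bounded function on a finite non-zero measure space converge to its essential
  supremum \<open>D\<close>. From above, the norm is at most \<open>D\<close> times the \<open>p\<close>-th root of the total mass; from below, for
  \<open>a < D\<close>, it is at least \<open>a\<close> times the \<open>p\<close>-th root of the positive mass where the function exceeds \<open>a\<close>.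
\<close>

lemma death_Lp_limit:
  assumes nz: "emeasure \<mu> Delta \<noteq> 0"
  obtains D where "0 < D" "AE x in \<mu>. snd x \<le> D"
    "((\<lambda>p. (\<integral>x. snd x powr p \<partial>\<mu>) powr (1 / p)) \<longlongrightarrow> D) at_top"
proof -
  define S where "S = {a. 0 \<le> a \<and> (AE x in \<mu>. snd x \<le> a)}"
  define D where "D = Inf S"
  have "AE x in \<mu>. snd x \<le> \<bar>R\<bar>" using AE_pers by eventually_elim auto
  then have S_ne: "\<bar>R\<bar> \<in> S" by (simp add: S_def)
  have bdd: "bdd_below S" by (rule bdd_belowI[of _ 0]) (simp add: S_def)
  have D_AE: "AE x in \<mu>. snd x \<le> D"
  proof -
    have "AE x in \<mu>. snd x \<le> D + 1 / real (Suc n)" for n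
    proof -
      have "D < D + 1 / real (Suc n)" by simp
      then obtain a where "a \<in> S" "a < D + 1 / real (Suc n)"
        using cInf_lessD[of S "D + 1 / real (Suc n)"] S_ne unfolding D_def by blast
      then show ?thesis unfolding S_def by (auto elim!: eventually_mono)
    qed
    then have "AE x in \<mu>. \<forall>n. snd x \<le> D + 1 / real (Suc n)" by (simp add: AE_all_countable)
    then show ?thesis
    proof eventually_elim
      case (elim x)
      have "(\<lambda>n. D + 1 / real (Suc n)) \<longlonglongrightarrow> D + 0"
        by (intro tendsto_intros LIMSEQ_Suc[OF lim_1_over_n])
      then show ?case using elim by (intro LIMSEQ_le_const[of _ D]) auto
    qed
  qed
  have D_pos: "0 < D"
  proof (rule ccontr)
    assume "\<not> 0 < D"
    from AE_pers D_AE have "AE x in \<mu>. False"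
      by eventually_elim (use \<open>\<not> 0 < D\<close> in auto)
    then show False using not_AE_False[OF nz] by blast
  qed
  have root: "((\<lambda>p::real. C * K powr (1 / p)) \<longlongrightarrow> C) at_top" if "0 < K" for C K :: real
  proof -
    have "((\<lambda>p::real. 1 / p) \<longlongrightarrow> 0) at_top"
      by (intro tendsto_divide_0[OF tendsto_const] filterlim_at_top_imp_at_infinity filterlim_ident)
    then have "((\<lambda>p::real. C * K powr (1 / p)) \<longlongrightarrow> C * K powr 0) at_top"
      using that by (intro tendsto_intros) auto
    then show ?thesis using that by simp
  qed
  have N: "0 < pd_number \<mu>" by (rule number_times_mean_pers(1)[OF zero_less_one nz])
  have "((\<lambda>p. (\<integral>x. snd x powr p \<partial>\<mu>) powr (1 / p)) \<longlongrightarrow> D) at_top"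
  proof (rule order_tendstoI)
    fix y assume "D < y"
    then have "\<forall>\<^sub>F p in at_top. D * pd_number \<mu> powr (1 / p) < y"
      using root[OF N, of D] by (auto dest: order_tendstoD(2))
    with eventually_gt_at_top[of 0]
    show "\<forall>\<^sub>F p in at_top. (\<integral>x. snd x powr p \<partial>\<mu>) powr (1 / p) < y"
    proof eventually_elim
      case (elim p)
      have "(\<integral>x. snd x powr p \<partial>\<mu>) \<le> (\<integral>x. D powr p \<partial>\<mu>)"
        using elim(1) AE_pers D_AE
        by (intro integral_mono_AE integrable_death_powr)
           (auto elim!: eventually_elim2 intro!: powr_mono2)
      also have "\<dots> = D powr p * pd_number \<mu>"
        by (simp add: pd_number_def space_eq)
      finally have "(\<integral>x. snd x powr p \<partial>\<mu>) powr (1 / p) \<le> (D powr p * pd_number \<mu>) powr (1 / p)"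
        using elim(1) by (intro powr_mono2) auto
      also have "\<dots> = D * pd_number \<mu> powr (1 / p)"
        using elim(1) D_pos N by (simp add: powr_mult powr_powr)
      finally show ?case using elim(2) by linarith
    qed
  next
    fix y assume "y < D"
    then obtain a where a: "max y 0 < a" "a < D" using dense[of "max y 0" D] D_pos by auto
    define A where "A = {x \<in> space \<mu>. a < snd x}"
    have A [measurable]: "A \<in> sets \<mu>" unfolding A_def by measurable
    have "a \<notin> S" using a cInf_lower[OF _ bdd, of a] by (auto simp: D_def)
    then have "\<not> (AE x in \<mu>. snd x \<le> a)" using a by (simp add: S_def)
    moreover have "AE x in \<mu>. snd x \<le> a" if "measure \<mu> A = 0"
    proof -
      have "A \<in> null_sets \<mu>" using that A by (simp add: null_sets_def emeasure_eq_measure)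
      then show ?thesis by (rule AE_I') (auto simp: A_def)
    qed
    ultimately have NA: "0 < measure \<mu> A" using measure_nonneg[of \<mu> A] by linarith
    have "\<forall>\<^sub>F p in at_top. y < a * measure \<mu> A powr (1 / p)"
      using root[OF NA, of a] a by (auto dest: order_tendstoD(1))
    with eventually_gt_at_top[of 0]
    show "\<forall>\<^sub>F p in at_top. y < (\<integral>x. snd x powr p \<partial>\<mu>) powr (1 / p)"
    proof eventually_elim
      case (elim p)
      have "a powr p * measure \<mu> A = (\<integral>x. a powr p * indicator A x \<partial>\<mu>)"
        using A by simp
      also have "\<dots> \<le> (\<integral>x. snd x powr p \<partial>\<mu>)"
      proof (rule integral_mono)
        show "integrable \<mu> (\<lambda>x. a powr p * indicator A x)"
          using A by (intro integrable_mult_right integrable_real_indicator) (auto simp: emeasure_eq_measure)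
        show "integrable \<mu> (\<lambda>x. snd x powr p)" by (rule integrable_death_powr[OF elim(1)])
        show "a powr p * indicator A x \<le> snd x powr p" for x
          using elim(1) a by (cases "x \<in> A") (auto simp: A_def intro!: powr_mono2)
      qed
      finally have "(a powr p * measure \<mu> A) powr (1 / p) \<le> (\<integral>x. snd x powr p \<partial>\<mu>) powr (1 / p)"
        using elim(1) by (intro powr_mono2) auto
      moreover have "(a powr p * measure \<mu> A) powr (1 / p) = a * measure \<mu> A powr (1 / p)"
        using elim(1) a NA by (simp add: powr_mult powr_powr)
      ultimately show ?case using elim(2) by linarith
    qed
  qed
  then show thesis using that D_pos D_AE by blast
qed

lemma max_death_expectation_eqI:
  assumes "((\<lambda>p. (\<integral>x. snd x powr p \<partial>\<mu>) powr (1 / p)) \<longlongrightarrow> D) at_top"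
  shows "max_death_expectation \<mu> = D"
  unfolding max_death_expectation_def using assms by (intro tendsto_Lim) auto

lemma extent_ratio_eq:
  assumes "0 < n" "0 < \<delta>" "emeasure \<mu> Delta \<noteq> 0"
  shows "extent_ratio n \<delta> \<mu> = max_death_expectation \<mu> powr \<delta> / (\<integral>x. pers x powr (n + \<delta>) \<partial>\<mu>)"
  unfolding extent_ratio_def using number_times_mean_pers(2)[of "n + \<delta>"] assms by simp

end

text \<open>
  The first measure is \<open>c\<close> times the image of the second one under the dilation \<open>x \<mapsto> x / \<kappa>\<close>. Deaths scale by
  \<open>1/\<kappa>\<close> and the moment of order \<open>n + \<delta>\<close> by \<open>c \<kappa>\<^bsup>-(n+\<delta>)\<^esup>\<close>, so the powers with exponent \<open>\<delta>\<close> cancel in the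
  ratio. The \<open>p\<close>-th root of \<open>c\<close> disappears in the limit of the \<open>L\<^sup>p\<close> norms.
\<close>

lemma extent_ratio_rescale:
  fixes \<kappa> c n \<delta> :: real
  assumes "bounded_diagram \<mu> R" "bounded_diagram \<mu>' R'"
    and pos: "0 < \<kappa>" "0 < c" "0 < n" "0 < \<delta>"
    and nz: "emeasure \<mu> Delta \<noteq> 0" "emeasure \<mu>' Delta \<noteq> 0"
    and scale: "\<And>B. B \<in> sets (restrict_space borel Delta) \<Longrightarrow>
        emeasure \<mu> B = ennreal c * emeasure \<mu>' ((\<lambda>(b, d). (\<kappa> * b, \<kappa> * d)) ` B)"
  shows "extent_ratio n \<delta> \<mu> = \<kappa> powr n / c * extent_ratio n \<delta> \<mu>'"
proof -
  interpret m: bounded_diagram \<mu> R by fact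
  interpret m': bounded_diagram \<mu>' R' by fact
  let ?D = "restrict_space borel Delta"
  define g :: "real \<times> real \<Rightarrow> real \<times> real" where "g x = x /\<^sub>R \<kappa>" for x
  have g_Delta: "g x \<in> Delta \<longleftrightarrow> x \<in> Delta" for x
    using pos by (cases x) (auto simp: g_def Delta_def)
  have g_meas0: "g \<in> borel \<rightarrow>\<^sub>M borel"
    unfolding g_def by measurable
  have g_meas: "g \<in> \<mu>' \<rightarrow>\<^sub>M ?D"
    unfolding m'.measurable_eq
    by (intro measurable_restrict_space2 measurable_restrict_space1 g_meas0)
       (auto simp: space_restrict_space g_Delta)
  have g_vimage: "g -` B \<inter> space \<mu>' = (\<lambda>(b, d). (\<kappa> * b, \<kappa> * d)) ` B" if "B \<subseteq> Delta" for B
  proof -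
    have *: "x \<in> (\<lambda>(b, d). (\<kappa> * b, \<kappa> * d)) ` B \<longleftrightarrow> g x \<in> B" for x
    proof
      assume "x \<in> (\<lambda>(b, d). (\<kappa> * b, \<kappa> * d)) ` B"
      then show "g x \<in> B" using pos by (auto simp: g_def mult.assoc[symmetric])
    next
      assume "g x \<in> B"
      moreover have "x = (\<lambda>(b, d). (\<kappa> * b, \<kappa> * d)) (g x)"
        using pos by (cases x) (auto simp: g_def)
      ultimately show "x \<in> (\<lambda>(b, d). (\<kappa> * b, \<kappa> * d)) ` B" by (rule rev_image_eqI)
    qed
    show ?thesis
    proof (rule set_eqI)
      fix x
      show "x \<in> g -` B \<inter> space \<mu>' \<longleftrightarrow> x \<in> (\<lambda>(b, d). (\<kappa> * b, \<kappa> * d)) ` B"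
        unfolding *[of x] using that g_Delta[of x] by (auto simp only: m'.space_eq vimage_eq Int_iff)
    qed
  qed
  have mu_eq: "\<mu> = distr (density \<mu>' (\<lambda>_. ennreal c)) ?D g"
  proof (rule measure_eqI)
    show "sets \<mu> = sets (distr (density \<mu>' (\<lambda>_. ennreal c)) ?D g)"
      by (simp add: m.sets_eq)
    fix B assume "B \<in> sets \<mu>"
    then have B: "B \<in> sets ?D" "B \<subseteq> Delta" by (auto simp: m.sets_eq sets_restrict_Delta)
    have "g -` B \<inter> space \<mu>' \<in> sets \<mu>'" by (rule measurable_sets[OF g_meas B(1)])
    then show "emeasure \<mu> B = emeasure (distr (density \<mu>' (\<lambda>_. ennreal c)) ?D g) B"
      using g_meas B by (simp add: emeasure_distr emeasure_density_const g_vimage scale)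
  qed
  have int: "(\<integral>x. f x \<partial>\<mu>) = c * (\<integral>x. f (g x) \<partial>\<mu>')" if "f \<in> borel_measurable ?D" for f :: "_ \<Rightarrow> real"
  proof -
    have "(\<integral>x. f x \<partial>\<mu>) = (\<integral>x. f (g x) \<partial>density \<mu>' (\<lambda>_. ennreal c))"
      unfolding mu_eq using g_meas that by (intro integral_distr) auto
    also have "\<dots> = (\<integral>x. c *\<^sub>R f (g x) \<partial>\<mu>')"
      using g_meas that pos by (intro integral_density) auto
    finally show ?thesis by simp
  qed
  have pers_scale: "(\<integral>x. pers x powr q \<partial>\<mu>) = c * \<kappa> powr (- q) * (\<integral>x. pers x powr q \<partial>\<mu>')" for q
  proof -
    have "(\<integral>x. pers (g x) powr q \<partial>\<mu>') = (\<integral>x. \<kappa> powr (- q) * pers x powr q \<partial>\<mu>')"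
    proof (rule integral_cong_AE)
      show "AE x in \<mu>'. pers (g x) powr q = \<kappa> powr (- q) * pers x powr q"
        using m'.AE_pers
      proof eventually_elim
        case (elim x)
        have *: "pers (g x) = pers x / \<kappa>" by (simp add: pers_def g_def diff_divide_distrib divide_inverse algebra_simps)
        show ?case unfolding * using elim pos by (simp add: powr_divide powr_minus_divide)
      qed
    qed (use g_meas m.measurable_pers in \<open>auto simp: m.measurable_eq\<close>)
    then show ?thesis
      using int[of "\<lambda>x. pers x powr q"] m.measurable_pers by (simp add: m.measurable_eq)
  qed
  have death_scale: "(\<integral>x. snd x powr q \<partial>\<mu>) = c * \<kappa> powr (- q) * (\<integral>x. snd x powr q \<partial>\<mu>')" for q
  proof -
    have "(\<integral>x. snd (g x) powr q \<partial>\<mu>') = (\<integral>x. \<kappa> powr (- q) * snd x powr q \<partial>\<mu>')"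
    proof (rule integral_cong_AE)
      show "AE x in \<mu>'. snd (g x) powr q = \<kappa> powr (- q) * snd x powr q"
        using m'.AE_pers
      proof eventually_elim
        case (elim x)
        have *: "snd (g x) = snd x / \<kappa>" by (simp add: g_def divide_inverse)
        show ?case unfolding * using elim pos by (simp add: powr_divide powr_minus_divide)
      qed
    qed (use g_meas m.measurable_snd' in \<open>auto simp: m.measurable_eq\<close>)
    then show ?thesis
      using int[of "\<lambda>x. snd x powr q"] m.measurable_snd' by (simp add: m.measurable_eq)
  qed
  obtain D where D: "0 < D" "((\<lambda>p. (\<integral>x. snd x powr p \<partial>\<mu>') powr (1 / p)) \<longlongrightarrow> D) at_top"
    by (rule m'.death_Lp_limit[OF nz(2)])
  have "((\<lambda>p::real. 1 / p) \<longlongrightarrow> 0) at_top"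
    by (intro tendsto_divide_0[OF tendsto_const] filterlim_at_top_imp_at_infinity filterlim_ident)
  then have "((\<lambda>p. c powr (1 / p) * \<kappa> powr (- 1) * (\<integral>x. snd x powr p \<partial>\<mu>') powr (1 / p))
      \<longlongrightarrow> c powr 0 * \<kappa> powr (- 1) * D) at_top"
    using pos by (intro tendsto_intros D) auto
  also have "c powr 0 * \<kappa> powr (- 1) * D = D / \<kappa>"
    using pos by (simp add: powr_minus_divide)
  also have "((\<lambda>p. c powr (1 / p) * \<kappa> powr (- 1) * (\<integral>x. snd x powr p \<partial>\<mu>') powr (1 / p)) \<longlongrightarrow> D / \<kappa>) at_top
    \<longleftrightarrow> ((\<lambda>p. (\<integral>x. snd x powr p \<partial>\<mu>) powr (1 / p)) \<longlongrightarrow> D / \<kappa>) at_top"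
  proof (rule filterlim_cong[OF refl refl])
    show "\<forall>\<^sub>F p in at_top. c powr (1 / p) * \<kappa> powr (- 1) * (\<integral>x. snd x powr p \<partial>\<mu>') powr (1 / p)
        = (\<integral>x. snd x powr p \<partial>\<mu>) powr (1 / p)"
      using eventually_gt_at_top[of 0]
    proof eventually_elim
      case (elim p)
      have "0 \<le> (\<integral>x. snd x powr p \<partial>\<mu>')" by simp
      then show ?case using elim pos by (simp add: death_scale powr_mult powr_powr)
    qed
  qed
  finally have "max_death_expectation \<mu> = D / \<kappa>" by (rule m.max_death_expectation_eqI)
  moreover have "max_death_expectation \<mu>' = D" using D(2) by (rule m'.max_death_expectation_eqI)
  moreover have "0 < (\<integral>x. pers x powr (n + \<delta>) \<partial>\<mu>')"
    using pos by (intro m'.pers_moment_pos nz) simp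
  moreover have "(D / \<kappa>) powr \<delta> = D powr \<delta> / \<kappa> powr \<delta>"
    using pos D(1) by (simp add: powr_divide)
  moreover have "\<kappa> powr (- (n + \<delta>)) = 1 / (\<kappa> powr n * \<kappa> powr \<delta>)"
    by (simp only: powr_minus_divide powr_add)
  moreover have "x / u / (c * (1 / (v * u)) * I) = v / c * (x / I)" if "0 < u" "0 < v" "0 < I" for x u v I :: real
    using that pos by (simp add: field_simps)
  ultimately show ?thesis
    unfolding m.extent_ratio_eq[OF pos(3,4) nz(1)] m'.extent_ratio_eq[OF pos(3,4) nz(2)] pers_scale
    using pos by simp
qed

section \<open>Integer-valued measures and their atoms\<close>

definition integer_measure :: "'a::euclidean_space measure \<Rightarrow> bool" where
  "integer_measure \<mu> \<longleftrightarrow> sets \<mu> = sets borel \<and> (\<forall>A\<in>bounded_borel. \<exists>m::nat. emeasure \<mu> A = of_nat m)"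

lemma bounded_borel_Diff: "A \<in> bounded_borel \<Longrightarrow> B \<in> sets borel \<Longrightarrow> A - B \<in> bounded_borel"
  by (auto simp: bounded_borel_def intro: bounded_subset)

lemma singleton_bounded_borel [simp]: "{x} \<in> bounded_borel"
  by (simp add: bounded_borel_def)

text \<open>
  Take a subset \<open>B\<close> of \<open>A\<close> of the least possible positive mass \<open>m\<close>. Every Borel set cuts \<open>B\<close> into pieces of mass
  0 and \<open>m\<close>. Discarding the countably many basic open sets that meet \<open>B\<close> in a null set leaves mass \<open>m\<close>, and two
  distinct remaining points would have disjoint neighbourhoods which both carry the whole mass.
\<close>

lemma integer_measure_has_atom:
  fixes \<mu> :: "'a::euclidean_space measure"
  assumes \<mu>: "integer_measure \<mu>" and A: "A \<in> bounded_borel" and pos: "emeasure \<mu> A \<noteq> 0"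
  shows "\<exists>x\<in>A. emeasure \<mu> {x} \<noteq> 0"
proof -
  have sets: "sets \<mu> = sets borel" using \<mu> by (simp add: integer_measure_def)
  define Q where "Q m \<longleftrightarrow> 0 < m \<and> (\<exists>B\<in>sets borel. B \<subseteq> A \<and> emeasure \<mu> B = of_nat m)" for m :: nat
  obtain m0 :: nat where "emeasure \<mu> A = of_nat m0"
    using \<mu> A by (auto simp: integer_measure_def)
  then have "Q m0" using pos A by (auto simp: Q_def bounded_borel_def)
  define m where "m = (LEAST m. Q m)"
  have "Q m" unfolding m_def using \<open>Q m0\<close> by (rule LeastI)
  then obtain B where B: "0 < m" "B \<in> sets borel" "B \<subseteq> A" "emeasure \<mu> B = of_nat m"
    by (auto simp: Q_def)
  have two_valued: "emeasure \<mu> (B \<inter> C) = of_nat m" if "C \<in> sets borel" "emeasure \<mu> (B \<inter> C) \<noteq> 0" for C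
  proof -
    have "B \<inter> C \<in> bounded_borel"
      using A B that by (auto simp: bounded_borel_def intro: bounded_subset)
    then obtain k :: nat where k: "emeasure \<mu> (B \<inter> C) = of_nat k"
      using \<mu> by (auto simp: integer_measure_def)
    have "emeasure \<mu> (B \<inter> C) \<le> emeasure \<mu> B" using B by (intro emeasure_mono) (auto simp: sets)
    then have "k \<le> m" using k B by simp
    moreover have "Q k"
      unfolding Q_def using k that B by (intro conjI bexI[of _ "B \<inter> C"]) auto
    then have "m \<le> k" unfolding m_def by (rule Least_le)
    ultimately show ?thesis using k by simp
  qed
  obtain \<B> :: "'a set set" where \<B>: "countable \<B>" "topological_basis \<B>"
    using ex_countable_basis by blast
  have \<B>_borel: "V \<in> sets borel" if "V \<in> \<B>" for V
    using topological_basis_open[OF \<B>(2) that] by simp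
  define U where "U = (\<Union>V\<in>{V \<in> \<B>. emeasure \<mu> (B \<inter> V) = 0}. V)"
  have U: "U \<in> sets borel"
    unfolding U_def using \<B>(1) \<B>_borel by (intro sets.countable_UN') auto
  have "(\<Union>V\<in>{V \<in> \<B>. emeasure \<mu> (B \<inter> V) = 0}. B \<inter> V) \<in> null_sets \<mu>"
    using \<B>(1) \<B>_borel B by (intro null_sets_UN') (auto simp: null_sets_def sets)
  moreover have "(\<Union>V\<in>{V \<in> \<B>. emeasure \<mu> (B \<inter> V) = 0}. B \<inter> V) = B \<inter> U"
    unfolding U_def by blast
  ultimately have BU: "B \<inter> U \<in> null_sets \<mu>" by simp
  have rest: "emeasure \<mu> (B - U) = of_nat m"
    using emeasure_Diff_null_set[OF BU, of B] B by (simp add: sets Diff_Int)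
  then obtain x where x: "x \<in> B" "x \<notin> U" using B(1) by (cases "B - U = {}") auto
  have "y = x" if y: "y \<in> B" "y \<notin> U" for y
  proof (rule ccontr)
    assume "y \<noteq> x"
    then obtain V W where VW: "open V" "open W" "x \<in> V" "y \<in> W" "V \<inter> W = {}"
      using hausdorff[of x y] by metis
    obtain V' where V': "V' \<in> \<B>" "x \<in> V'" "V' \<subseteq> V" using topological_basisE[OF \<B>(2) VW(1,3)] .
    obtain W' where W': "W' \<in> \<B>" "y \<in> W'" "W' \<subseteq> W" using topological_basisE[OF \<B>(2) VW(2,4)] .
    have "emeasure \<mu> (B \<inter> V') \<noteq> 0" using V' x by (auto simp: U_def)
    then have V'_m: "emeasure \<mu> (B \<inter> V') = of_nat m" using two_valued \<B>_borel V' by blast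
    have "emeasure \<mu> (B \<inter> W') \<noteq> 0" using W' y by (auto simp: U_def)
    then have W'_m: "emeasure \<mu> (B \<inter> W') = of_nat m" using two_valued \<B>_borel W' by blast
    have "emeasure \<mu> (B \<inter> V') + emeasure \<mu> (B \<inter> W') = emeasure \<mu> (B \<inter> V' \<union> B \<inter> W')"
      using V' W' VW(5) B \<B>_borel by (intro plus_emeasure) (auto simp: sets)
    also have "\<dots> \<le> emeasure \<mu> B" using B by (intro emeasure_mono) (auto simp: sets)
    finally have "of_nat (m + m) \<le> (of_nat m :: ennreal)" using V'_m W'_m B by simp
    then show False using B(1) unfolding of_nat_le_iff by simp
  qed
  then have "B - U = {x}" using x by blast
  then have "emeasure \<mu> {x} \<noteq> 0" using rest B(1) by simp
  then show ?thesis using x B(3) by blast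
qed

lemma two_atoms:
  fixes \<mu> :: "'a::euclidean_space measure"
  assumes \<mu>: "integer_measure \<mu>" and simple: "\<And>x. emeasure \<mu> {x} \<le> 1"
    and A: "A \<in> bounded_borel" and two: "1 < emeasure \<mu> A"
  obtains x y where "x \<in> atoms_in \<mu> A" "y \<in> atoms_in \<mu> A" "x \<noteq> y"
proof -
  have sets: "sets \<mu> = sets borel" using \<mu> by (simp add: integer_measure_def)
  have "emeasure \<mu> A \<noteq> 0" using two by auto
  then obtain x where x: "x \<in> A" "emeasure \<mu> {x} \<noteq> 0"
    using integer_measure_has_atom[OF \<mu> A] by blast
  have A': "A - {x} \<in> bounded_borel" using A by (rule bounded_borel_Diff) simp
  have "emeasure \<mu> A \<le> emeasure \<mu> {x} + emeasure \<mu> (A - {x})"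
  proof -
    have "A = {x} \<union> (A - {x})" using x by blast
    then show ?thesis
      using emeasure_subadditive[of "{x}" \<mu> "A - {x}"] A' by (simp add: sets bounded_borel_def)
  qed
  also have "\<dots> \<le> 1 + emeasure \<mu> (A - {x})" by (rule add_right_mono[OF simple])
  finally have "emeasure \<mu> (A - {x}) \<noteq> 0" using two by auto
  then obtain y where y: "y \<in> A - {x}" "emeasure \<mu> {y} \<noteq> 0"
    using integer_measure_has_atom[OF \<mu> A'] by blast
  show thesis by (rule that[of x y]) (use x y in \<open>auto simp: atoms_in_def zero_less_iff_neq_zero\<close>)
qed

lemma card_atoms_le:
  fixes \<mu> :: "'a::euclidean_space measure"
  assumes \<mu>: "integer_measure \<mu>" and A: "A \<in> bounded_borel"
  shows "finite (atoms_in \<mu> A)" "of_nat (card (atoms_in \<mu> A)) \<le> emeasure \<mu> A"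
proof -
  have sets: "sets \<mu> = sets borel" using \<mu> by (simp add: integer_measure_def)
  obtain m :: nat where m: "emeasure \<mu> A = of_nat m" using \<mu> A by (auto simp: integer_measure_def)
  have "card F \<le> m" if F: "F \<subseteq> atoms_in \<mu> A" "finite F" for F
  proof -
    have one: "1 \<le> emeasure \<mu> {x}" if "x \<in> F" for x
    proof -
      obtain k :: nat where k: "emeasure \<mu> {x} = of_nat k"
        using \<mu> singleton_bounded_borel[of x] unfolding integer_measure_def by blast
      then have "k \<noteq> 0" using F that by (auto simp: atoms_in_def)
      then have "1 \<le> k" by simp
      then show ?thesis using k of_nat_mono[of 1 k, where ?'a = ennreal] by simp
    qed
    have "of_nat (card F) = (\<Sum>x\<in>F. 1 :: ennreal)" by simp
    also have "\<dots> \<le> (\<Sum>x\<in>F. emeasure \<mu> {x})" by (rule sum_mono) (rule one)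
    also have "\<dots> = emeasure \<mu> F"
      using F by (intro emeasure_eq_sum_singleton[symmetric]) (auto simp: sets)
    also have "\<dots> \<le> emeasure \<mu> A"
      using F A by (intro emeasure_mono) (auto simp: atoms_in_def sets bounded_borel_def)
    finally show ?thesis unfolding m of_nat_le_iff .
  qed
  then have "finite (atoms_in \<mu> A) \<and> card (atoms_in \<mu> A) \<le> m"
    by (intro finite_if_finite_subsets_card_bdd) auto
  then show "finite (atoms_in \<mu> A)" "of_nat (card (atoms_in \<mu> A)) \<le> emeasure \<mu> A"
    unfolding m of_nat_le_iff by auto
qed

section \<open>Intensity of stationary point processes\<close>

lemma space_bf_measures:
  "space (bf_measures :: 'a::euclidean_space measure measure) =
     {\<mu>. sets \<mu> = sets borel \<and> (\<forall>A\<in>bounded_borel. emeasure \<mu> A < \<infinity>)}"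
proof -
  have "({} :: 'a set) \<in> bounded_borel" by (simp add: bounded_borel_def)
  then show ?thesis unfolding bf_measures_def by (auto simp: space_Sup_eq_UN)
qed

lemma measurable_emeasure_bf:
  "A \<in> bounded_borel \<Longrightarrow> (\<lambda>\<mu>. emeasure \<mu> A) \<in> borel_measurable bf_measures"
  unfolding bf_measures_def
  by (rule measurable_SUP1[of A]) (auto intro!: measurable_vimage_algebra1)

lemma vimage_shift_bounded_borel:
  fixes A :: "'a::euclidean_space set"
  assumes "A \<in> bounded_borel"
  shows "(\<lambda>y. y - x) -` A \<in> bounded_borel"
proof -
  have "(\<lambda>y. y - x) -` A = (\<lambda>y. x + y) ` A"
    by (auto simp: image_iff intro!: bexI[of _ "_ - x"])
  moreover have "(\<lambda>y. y - x) -` A \<inter> space borel \<in> sets borel"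
    using assms by (intro measurable_sets[of _ borel borel]) (auto simp: bounded_borel_def)
  ultimately show ?thesis
    using assms bounded_translation[of A x] by (simp add: bounded_borel_def)
qed

lemma emeasure_shift:
  fixes \<mu> :: "'a::euclidean_space measure"
  assumes "sets \<mu> = sets borel" "A \<in> bounded_borel"
  shows "emeasure (shift x \<mu>) A = emeasure \<mu> ((\<lambda>y. y - x) -` A)"
proof -
  have "(\<lambda>y. y - x) \<in> \<mu> \<rightarrow>\<^sub>M borel"
    unfolding measurable_cong_sets[OF assms(1) refl] by measurable
  moreover have "space \<mu> = UNIV" using sets_eq_imp_space_eq[OF assms(1)] by simp
  ultimately show ?thesis
    unfolding shift_def using assms by (simp add: emeasure_distr bounded_borel_def)
qed

lemma measurable_shift: "shift x \<in> bf_measures \<rightarrow>\<^sub>M (bf_measures :: 'a::euclidean_space measure measure)"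
proof -
  let ?\<Omega> = "{\<mu> :: 'a measure. sets \<mu> = sets borel \<and> (\<forall>A\<in>bounded_borel. emeasure \<mu> A < \<infinity>)}"
  have ne: "(bounded_borel :: 'a set set) \<noteq> {}" using singleton_bounded_borel by blast
  have "shift x \<in> bf_measures \<rightarrow>\<^sub>M vimage_algebra ?\<Omega> (\<lambda>\<mu>. emeasure \<mu> A) borel"
    if A: "A \<in> bounded_borel" for A :: "'a set"
  proof (rule measurable_vimage_algebra2)
    show "shift x \<in> space bf_measures \<rightarrow> ?\<Omega>"
    proof
      fix \<mu> :: "'a measure" assume "\<mu> \<in> space bf_measures"
      then have \<mu>: "sets \<mu> = sets borel" "\<And>A. A \<in> bounded_borel \<Longrightarrow> emeasure \<mu> A < \<infinity>"
        by (auto simp: space_bf_measures)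
      then show "shift x \<mu> \<in> ?\<Omega>"
        using emeasure_shift[OF \<mu>(1)] vimage_shift_bounded_borel[of _ x]
        by (auto simp: shift_def simp del: emeasure_distr)
    qed
    have "(\<lambda>\<mu>. emeasure \<mu> ((\<lambda>y. y - x) -` A)) \<in> borel_measurable bf_measures"
      by (rule measurable_emeasure_bf[OF vimage_shift_bounded_borel[OF A]])
    then show "(\<lambda>\<mu>. emeasure (shift x \<mu>) A) \<in> borel_measurable bf_measures"
      by (rule measurable_cong[THEN iffD1, rotated]) (simp add: space_bf_measures emeasure_shift A)
  qed
  then show ?thesis
    unfolding bf_measures_def[symmetric]
    by (subst (2) bf_measures_def, intro measurable_SUP2 ne) auto
qed

lemma point_process_integer:
  assumes "point_process M \<xi>" "\<omega> \<in> space M"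
  shows "integer_measure (\<xi> \<omega>)"
proof -
  have "\<xi> \<omega> \<in> space bf_measures"
    using assms by (auto simp: point_process_def dest: measurable_space)
  then show ?thesis using assms by (auto simp: integer_measure_def space_bf_measures point_process_def)
qed

lemma measurable_counts:
  assumes "point_process M \<xi>" "A \<in> bounded_borel"
  shows "(\<lambda>\<omega>. emeasure (\<xi> \<omega>) A) \<in> borel_measurable M"
  using assms measurable_compose[OF _ measurable_emeasure_bf, of \<xi> M A]
  by (simp add: point_process_def)

lemma stationary_intensity:
  fixes A :: "'a::euclidean_space set"
  assumes pp: "point_process M \<xi>" and st: "stationary M \<xi>" and A: "A \<in> bounded_borel"
  shows "(\<integral>\<^sup>+\<omega>. emeasure (\<xi> \<omega>) ((\<lambda>y. y - x) -` A) \<partial>M) = (\<integral>\<^sup>+\<omega>. emeasure (\<xi> \<omega>) A \<partial>M)"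
proof -
  have \<xi>: "\<xi> \<in> M \<rightarrow>\<^sub>M bf_measures" using pp by (simp add: point_process_def)
  have "(\<integral>\<^sup>+\<omega>. emeasure (\<xi> \<omega>) ((\<lambda>y. y - x) -` A) \<partial>M) = (\<integral>\<^sup>+\<omega>. emeasure (shift x (\<xi> \<omega>)) A \<partial>M)"
    using point_process_integer[OF pp] A
    by (intro nn_integral_cong) (simp add: emeasure_shift integer_measure_def)
  also have "\<dots> = (\<integral>\<^sup>+\<mu>. emeasure \<mu> A \<partial>distr M bf_measures (\<lambda>\<omega>. shift x (\<xi> \<omega>)))"
    by (rule nn_integral_distr[symmetric])
       (use measurable_compose[OF \<xi> measurable_shift] measurable_emeasure_bf[OF A] in auto)
  also have "\<dots> = (\<integral>\<^sup>+\<mu>. emeasure \<mu> A \<partial>distr M bf_measures \<xi>)"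
    using st by (simp add: stationary_def)
  also have "\<dots> = (\<integral>\<^sup>+\<omega>. emeasure (\<xi> \<omega>) A \<partial>M)"
    by (rule nn_integral_distr[OF \<xi>]) (use measurable_emeasure_bf[OF A] in auto)
  finally show ?thesis .
qed

text \<open>
  By stationarity all unit balls have the same positive mean number of points, and a large ball contains many
  disjoint unit balls.
\<close>

lemma intensity_of_large_ball:
  fixes \<xi> :: "'w \<Rightarrow> 'a::euclidean_space measure"
  assumes pp: "point_process M \<xi>" and st: "stationary M \<xi>" and inten: "positive_intensity M \<xi>"
  shows "\<exists>r0. \<forall>A\<in>bounded_borel. \<forall>x. ball x r0 \<subseteq> A \<longrightarrow> 1 < (\<integral>\<^sup>+\<omega>. emeasure (\<xi> \<omega>) A \<partial>M)"
proof -
  have ball: "ball x r \<in> bounded_borel" for x :: 'a and r by (simp add: bounded_borel_def)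
  define m where "m = (\<integral>\<^sup>+\<omega>. emeasure (\<xi> \<omega>) (ball 0 1) \<partial>M)"
  have "0 < emeasure lborel (ball 0 1 :: 'a set)"
    by (simp add: emeasure_ball)
  then have "0 < m"
    unfolding m_def using inten ball by (auto simp: positive_intensity_def)
  then obtain z where "0 < z" "z < m" using dense by blast
  then obtain e where e: "0 < e" "ennreal e \<le> m"
    by (cases z) (auto simp: less_imp_le)
  obtain N :: nat where N: "1 < real N * e" using reals_Archimedean3[OF e(1)] by blast
  have "ennreal 1 < ennreal (real N * e)" using N by (intro ennreal_lessI) auto
  also have "\<dots> = of_nat N * ennreal e"
    using e by (simp add: ennreal_mult ennreal_of_nat_eq_real_of_nat)
  also have "\<dots> \<le> of_nat N * m" using e by (intro mult_left_mono) auto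
  finally have Nm: "1 < of_nat N * m" by simp
  have "1 < (\<integral>\<^sup>+\<omega>. emeasure (\<xi> \<omega>) A \<partial>M)"
    if A: "A \<in> bounded_borel" "ball x (3 * real N) \<subseteq> A" for A and x :: 'a
  proof -
    \<comment> \<open>The centres lie on a ray, at a distance 3 from one another, which separates the unit balls.\<close>
    obtain u :: 'a where u: "norm u = 1" using norm_Basis nonempty_Basis by blast
    define c where "c i = x + (3 * real i) *\<^sub>R u" for i
    have dist_c: "dist (c i) (c j) = 3 * \<bar>real i - real j\<bar>" for i j
    proof -
      have "c i - c j = (3 * (real i - real j)) *\<^sub>R u" by (simp add: c_def algebra_simps)
      then show ?thesis by (simp only: dist_norm norm_scaleR u abs_mult abs_numeral mult_1_right)
    qed
    have disj: "disjoint_family_on (\<lambda>i. ball (c i) 1) {..<N}"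
      unfolding disjoint_family_on_def
    proof (intro ballI impI)
      fix i j :: nat assume "i \<noteq> j"
      then have "1 \<le> \<bar>real i - real j\<bar>" by linarith
      then have "3 * 1 \<le> dist (c i) (c j)" unfolding dist_c by (intro mult_left_mono) auto
      then have "1 + 1 \<le> dist (c i) (c j)" by simp
      then show "ball (c i) 1 \<inter> ball (c j) 1 = {}" by (rule disjoint_ballI)
    qed
    have sub: "ball (c i) 1 \<subseteq> A" if "i < N" for i
    proof -
      have "dist x (c i) = 3 * real i" using u by (simp add: c_def dist_norm)
      moreover have "real i + 1 \<le> real N" using that by linarith
      ultimately have "dist x (c i) + 1 \<le> 3 * real N" by linarith
      then have "ball (c i) 1 \<subseteq> ball x (3 * real N)"
        by (simp add: ball_subset_ball_iff dist_commute)
      then show ?thesis using A by blast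
    qed
    have "(\<lambda>y. y - c i) -` ball 0 1 = ball (c i) 1" for i by (auto simp: dist_norm norm_minus_commute)
    then have each: "(\<integral>\<^sup>+\<omega>. emeasure (\<xi> \<omega>) (ball (c i) 1) \<partial>M) = m" for i
      using stationary_intensity[OF pp st ball[of 0 1], of "c i"] by (simp add: m_def)
    have "of_nat N * m = (\<Sum>i<N. (\<integral>\<^sup>+\<omega>. emeasure (\<xi> \<omega>) (ball (c i) 1) \<partial>M))"
      by (simp add: each)
    also have "\<dots> = (\<integral>\<^sup>+\<omega>. (\<Sum>i<N. emeasure (\<xi> \<omega>) (ball (c i) 1)) \<partial>M)"
      by (rule nn_integral_sum[symmetric]) (rule measurable_counts[OF pp ball])
    also have "\<dots> \<le> (\<integral>\<^sup>+\<omega>. emeasure (\<xi> \<omega>) A \<partial>M)"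
    proof (rule nn_integral_mono)
      fix \<omega> assume "\<omega> \<in> space M"
      then have sets: "sets (\<xi> \<omega>) = sets borel"
        using point_process_integer[OF pp] by (simp add: integer_measure_def)
      have "(\<Sum>i<N. emeasure (\<xi> \<omega>) (ball (c i) 1)) = emeasure (\<xi> \<omega>) (\<Union>i<N. ball (c i) 1)"
        using disj by (intro sum_emeasure) (auto simp: sets)
      also have "\<dots> \<le> emeasure (\<xi> \<omega>) A"
        using sub A by (intro emeasure_mono) (auto simp: sets bounded_borel_def)
      finally show "(\<Sum>i<N. emeasure (\<xi> \<omega>) (ball (c i) 1)) \<le> emeasure (\<xi> \<omega>) A" .
    qed
    finally show ?thesis using Nm by (rule order.strict_trans2[rotated])
  qed
  then show ?thesis by blast
qed

section \<open>The expected persistence diagram\<close>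

lemma bounded_borel_subset_cball:
  fixes A :: "'a::euclidean_space set"
  assumes "A \<in> bounded_borel"
  obtains R where "A \<subseteq> cball 0 R"
proof -
  obtain R where "A \<subseteq> ball 0 R"
    using bounded_subset_ballD[of A 0] assms by (auto simp: bounded_borel_def)
  then show thesis using that[of R] ball_subset_cball by blast
qed

lemma borel_measurable_power_ennreal:
  fixes f :: "'w \<Rightarrow> ennreal"
  assumes "f \<in> borel_measurable M"
  shows "(\<lambda>\<omega>. f \<omega> ^ e) \<in> borel_measurable M"
  by (induction e) (use assms in auto)

text \<open>
  If the values of a measure \<open>P\<close> are the averages of those of random measures \<open>K \<omega>\<close>, its integrals are the
  averages of theirs: by linearity and monotone convergence the identity passes from indicators to all
  non-negative functions. Unlike for kernels in the Giry monad, the masses of the measures are arbitrary.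
\<close>

lemma nn_integral_mixture:
  fixes K :: "'w \<Rightarrow> 'b measure" and P N :: "'b measure"
  assumes sets_P: "sets P = sets N" and sets_K: "\<And>\<omega>. \<omega> \<in> space M \<Longrightarrow> sets (K \<omega>) = sets N"
    and meas: "\<And>B. B \<in> sets N \<Longrightarrow> (\<lambda>\<omega>. emeasure (K \<omega>) B) \<in> borel_measurable M"
    and P: "\<And>B. B \<in> sets N \<Longrightarrow> emeasure P B = (\<integral>\<^sup>+\<omega>. emeasure (K \<omega>) B \<partial>M)"
    and f: "f \<in> borel_measurable N"
  shows "(\<lambda>\<omega>. \<integral>\<^sup>+x. f x \<partial>K \<omega>) \<in> borel_measurable M \<and>
    (\<integral>\<^sup>+x. f x \<partial>P) = (\<integral>\<^sup>+\<omega>. (\<integral>\<^sup>+x. f x \<partial>K \<omega>) \<partial>M)"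
  using f
proof (induction f rule: borel_measurable_induct)
  case (cong f g)
  have "(\<integral>\<^sup>+x. f x \<partial>P) = (\<integral>\<^sup>+x. g x \<partial>P)"
    using cong(3) sets_eq_imp_space_eq[OF sets_P] by (intro nn_integral_cong) simp
  moreover have inner: "(\<integral>\<^sup>+x. f x \<partial>K \<omega>) = (\<integral>\<^sup>+x. g x \<partial>K \<omega>)" if "\<omega> \<in> space M" for \<omega>
    using cong(3) sets_eq_imp_space_eq[OF sets_K[OF that]] by (intro nn_integral_cong) simp
  moreover have "(\<integral>\<^sup>+\<omega>. (\<integral>\<^sup>+x. f x \<partial>K \<omega>) \<partial>M) = (\<integral>\<^sup>+\<omega>. (\<integral>\<^sup>+x. g x \<partial>K \<omega>) \<partial>M)"
    by (rule nn_integral_cong[OF inner])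
  moreover have "(\<lambda>\<omega>. \<integral>\<^sup>+x. f x \<partial>K \<omega>) \<in> borel_measurable M \<longleftrightarrow> (\<lambda>\<omega>. \<integral>\<^sup>+x. g x \<partial>K \<omega>) \<in> borel_measurable M"
    by (rule measurable_cong[OF inner])
  ultimately show ?case using cong(4) by simp
next
  case (set B)
  have inner: "(\<integral>\<^sup>+x. indicator B x \<partial>K \<omega>) = emeasure (K \<omega>) B" if "\<omega> \<in> space M" for \<omega>
    using set sets_K[OF that] by simp
  have "(\<lambda>\<omega>. \<integral>\<^sup>+x. indicator B x \<partial>K \<omega>) \<in> borel_measurable M"
    using meas[OF set] by (subst measurable_cong[OF inner])
  moreover have "(\<integral>\<^sup>+\<omega>. (\<integral>\<^sup>+x. indicator B x \<partial>K \<omega>) \<partial>M) = (\<integral>\<^sup>+\<omega>. emeasure (K \<omega>) B \<partial>M)"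
    by (rule nn_integral_cong[OF inner])
  ultimately show ?case using set P sets_P by simp
next
  case (mult f c)
  have inner: "(\<integral>\<^sup>+x. c * f x \<partial>K \<omega>) = c * (\<integral>\<^sup>+x. f x \<partial>K \<omega>)" if "\<omega> \<in> space M" for \<omega>
    using mult(2) sets_K[OF that] by (intro nn_integral_cmult) (simp cong: measurable_cong_sets)
  have meas_f: "(\<lambda>\<omega>. \<integral>\<^sup>+x. f x \<partial>K \<omega>) \<in> borel_measurable M" using mult by simp
  then have "(\<lambda>\<omega>. c * (\<integral>\<^sup>+x. f x \<partial>K \<omega>)) \<in> borel_measurable M" by measurable
  then have "(\<lambda>\<omega>. \<integral>\<^sup>+x. c * f x \<partial>K \<omega>) \<in> borel_measurable M"
    by (subst measurable_cong[OF inner])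
  moreover have "(\<integral>\<^sup>+\<omega>. (\<integral>\<^sup>+x. c * f x \<partial>K \<omega>) \<partial>M) = (\<integral>\<^sup>+\<omega>. c * (\<integral>\<^sup>+x. f x \<partial>K \<omega>) \<partial>M)"
    by (rule nn_integral_cong[OF inner])
  moreover have "(\<integral>\<^sup>+\<omega>. c * (\<integral>\<^sup>+x. f x \<partial>K \<omega>) \<partial>M) = c * (\<integral>\<^sup>+\<omega>. (\<integral>\<^sup>+x. f x \<partial>K \<omega>) \<partial>M)"
    by (rule nn_integral_cmult[OF meas_f])
  moreover have "(\<integral>\<^sup>+x. c * f x \<partial>P) = c * (\<integral>\<^sup>+x. f x \<partial>P)"
    using mult(2) sets_P by (intro nn_integral_cmult) (simp cong: measurable_cong_sets)
  ultimately show ?case using mult by simp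
next
  case (add f g)
  have inner: "(\<integral>\<^sup>+x. g x + f x \<partial>K \<omega>) = (\<integral>\<^sup>+x. g x \<partial>K \<omega>) + (\<integral>\<^sup>+x. f x \<partial>K \<omega>)" if "\<omega> \<in> space M" for \<omega>
    using add.hyps(1,3) sets_K[OF that] by (intro nn_integral_add) (simp_all cong: measurable_cong_sets)
  have meas_fg: "(\<lambda>\<omega>. \<integral>\<^sup>+x. f x \<partial>K \<omega>) \<in> borel_measurable M" "(\<lambda>\<omega>. \<integral>\<^sup>+x. g x \<partial>K \<omega>) \<in> borel_measurable M"
    using add by simp_all
  then have "(\<lambda>\<omega>. (\<integral>\<^sup>+x. g x \<partial>K \<omega>) + (\<integral>\<^sup>+x. f x \<partial>K \<omega>)) \<in> borel_measurable M" by measurable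
  then have "(\<lambda>\<omega>. \<integral>\<^sup>+x. g x + f x \<partial>K \<omega>) \<in> borel_measurable M"
    by (subst measurable_cong[OF inner])
  moreover have "(\<integral>\<^sup>+\<omega>. (\<integral>\<^sup>+x. g x + f x \<partial>K \<omega>) \<partial>M)
      = (\<integral>\<^sup>+\<omega>. (\<integral>\<^sup>+x. g x \<partial>K \<omega>) + (\<integral>\<^sup>+x. f x \<partial>K \<omega>) \<partial>M)"
    by (rule nn_integral_cong[OF inner])
  moreover have "\<dots> = (\<integral>\<^sup>+\<omega>. (\<integral>\<^sup>+x. g x \<partial>K \<omega>) \<partial>M) + (\<integral>\<^sup>+\<omega>. (\<integral>\<^sup>+x. f x \<partial>K \<omega>) \<partial>M)"
    by (rule nn_integral_add[OF meas_fg(2,1)])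
  moreover have "(\<integral>\<^sup>+x. g x + f x \<partial>P) = (\<integral>\<^sup>+x. g x \<partial>P) + (\<integral>\<^sup>+x. f x \<partial>P)"
    using add.hyps(1,3) sets_P by (intro nn_integral_add) (simp_all cong: measurable_cong_sets)
  ultimately show ?case using add by simp
next
  case (seq U)
  have sup: "(SUP i. U i) x = (SUP i. U i x)" for x by (simp add: SUP_apply image_comp)
  have inner: "(\<integral>\<^sup>+x. (SUP i. U i) x \<partial>K \<omega>) = (SUP i. \<integral>\<^sup>+x. U i x \<partial>K \<omega>)" if "\<omega> \<in> space M" for \<omega>
    unfolding sup using seq.hyps(1,3) sets_K[OF that]
    by (intro nn_integral_monotone_convergence_SUP) (simp_all cong: measurable_cong_sets)
  have meas_U: "(\<lambda>\<omega>. \<integral>\<^sup>+x. U i x \<partial>K \<omega>) \<in> borel_measurable M" for i using seq.IH by simp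
  then have "(\<lambda>\<omega>. SUP i. \<integral>\<^sup>+x. U i x \<partial>K \<omega>) \<in> borel_measurable M" by measurable
  then have "(\<lambda>\<omega>. \<integral>\<^sup>+x. (SUP i. U i) x \<partial>K \<omega>) \<in> borel_measurable M"
    by (subst measurable_cong[OF inner])
  moreover have "(\<integral>\<^sup>+\<omega>. (\<integral>\<^sup>+x. (SUP i. U i) x \<partial>K \<omega>) \<partial>M) = (\<integral>\<^sup>+\<omega>. (SUP i. \<integral>\<^sup>+x. U i x \<partial>K \<omega>) \<partial>M)"
    by (rule nn_integral_cong[OF inner])
  moreover have "\<dots> = (SUP i. \<integral>\<^sup>+\<omega>. (\<integral>\<^sup>+x. U i x \<partial>K \<omega>) \<partial>M)"
  proof (rule nn_integral_monotone_convergence_SUP[OF _ meas_U])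
    show "incseq (\<lambda>i \<omega>. \<integral>\<^sup>+x. U i x \<partial>K \<omega>)"
      using seq.hyps(3) by (auto simp: incseq_def le_fun_def intro!: nn_integral_mono)
  qed
  moreover have "(\<integral>\<^sup>+x. (SUP i. U i) x \<partial>P) = (SUP i. \<integral>\<^sup>+x. U i x \<partial>P)"
    unfolding sup using seq.hyps(1,3) sets_P
    by (intro nn_integral_monotone_convergence_SUP) (simp_all cong: measurable_cong_sets)
  ultimately show ?case using seq.IH by simp
qed

locale diagram_process = prob_space M for M :: "'w measure" +
  fixes k :: "'k::field itself" and \<xi> :: "'w \<Rightarrow> 'a::euclidean_space measure"
  assumes point_process: "point_process M \<xi>"
    and moments: "all_finite_moments M \<xi>"
    and exists: "pd_expectation_exists k M \<xi>"
begin

lemmas integer = point_process_integer[OF point_process]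

lemma sets_pd_measure: "sets (pd_measure k \<xi> \<omega> A) = sets (restrict_space borel Delta)"
  unfolding pd_measure_def by (rule sets_diagram_measure)

lemma sets_pd_expectation: "sets (pd_expectation k M \<xi> A) = sets (restrict_space borel Delta)"
  unfolding pd_expectation_def by (rule sets_measure_of_Delta)

lemma Delta_in_sets: "Delta \<in> sets (restrict_space borel Delta)"
  by (simp add: sets_restrict_Delta sets_borel_Delta)

lemma set_mset_diagram:
  assumes "\<omega> \<in> space M" "A \<in> bounded_borel" "A \<subseteq> cball 0 R"
  shows "set_mset (pd_union k (atoms_in (\<xi> \<omega>) A)) \<subseteq> {(b, d). b < d \<and> 0 \<le> b \<and> d \<le> R}"
  using assms by (intro set_mset_pd_union card_atoms_le(1)[OF integer]) (auto simp: atoms_in_def)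

lemma emeasure_pd_measure:
  "B \<in> sets (restrict_space borel Delta) \<Longrightarrow>
    emeasure (pd_measure k \<xi> \<omega> A) B = of_nat (size (filter_mset (\<lambda>x. x \<in> B) (pd_union k (atoms_in (\<xi> \<omega>) A))))"
  unfolding pd_measure_def by (rule emeasure_diagram_measure)

lemma emeasure_pd_measure_Delta:
  assumes "\<omega> \<in> space M" "A \<in> bounded_borel"
  shows "emeasure (pd_measure k \<xi> \<omega> A) Delta = of_nat (size (pd_union k (atoms_in (\<xi> \<omega>) A)))"
proof -
  obtain R where "A \<subseteq> cball 0 R"
    using assms(2) by (rule bounded_borel_subset_cball)
  then have "x \<in> Delta" if "x \<in># pd_union k (atoms_in (\<xi> \<omega>) A)" for x
    using set_mset_diagram[OF assms, of R] that by (auto simp: Delta_def)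
  then have "filter_mset (\<lambda>x. x \<in> Delta) (pd_union k (atoms_in (\<xi> \<omega>) A))
      = filter_mset (\<lambda>_. True) (pd_union k (atoms_in (\<xi> \<omega>) A))"
    by (intro filter_mset_cong) auto
  then show ?thesis by (simp add: emeasure_pd_measure[OF Delta_in_sets])
qed

lemma bounded_diagram_pd_measure:
  assumes "\<omega> \<in> space M" "A \<in> bounded_borel" "A \<subseteq> cball 0 R"
  shows "bounded_diagram (pd_measure k \<xi> \<omega> A) R"
proof
  show "sets (pd_measure k \<xi> \<omega> A) = sets (restrict_space borel Delta)" by (rule sets_pd_measure)
  show "emeasure (pd_measure k \<xi> \<omega> A) Delta < \<infinity>"
    by (simp add: emeasure_pd_measure_Delta[OF assms(1,2)] of_nat_less_top)
  let ?N = "{x \<in> Delta. \<not> (0 \<le> fst x \<and> snd x \<le> R)}"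
  note N = out_of_bounds_measurable[of R]
  have "filter_mset (\<lambda>x. x \<in> ?N) (pd_union k (atoms_in (\<xi> \<omega>) A)) = {#}"
    using set_mset_diagram[OF assms] by auto
  then have "?N \<in> null_sets (pd_measure k \<xi> \<omega> A)"
    using N by (simp add: null_sets_def sets_pd_measure emeasure_pd_measure)
  moreover have "space (pd_measure k \<xi> \<omega> A) = Delta"
    using sets_eq_imp_space_eq[OF sets_pd_measure] by (simp add: space_restrict_space)
  ultimately show "AE x in pd_measure k \<xi> \<omega> A. 0 \<le> fst x \<and> snd x \<le> R"
    by (intro AE_I') auto
qed

lemma measurable_pd_measure:
  "A \<in> bounded_borel \<Longrightarrow> B \<in> sets (restrict_space borel Delta) \<Longrightarrow>
    (\<lambda>\<omega>. emeasure (pd_measure k \<xi> \<omega> A) B) \<in> borel_measurable M"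
  using exists by (auto simp: pd_expectation_exists_def sets_restrict_Delta)

lemma emeasure_pd_expectation:
  assumes A: "A \<in> bounded_borel" and B: "B \<in> sets (restrict_space borel Delta)"
  shows "emeasure (pd_expectation k M \<xi> A) B = (\<integral>\<^sup>+\<omega>. emeasure (pd_measure k \<xi> \<omega> A) B \<partial>M)"
proof -
  have "countably_additive (sets (restrict_space borel Delta)) (\<lambda>B. \<integral>\<^sup>+\<omega>. emeasure (pd_measure k \<xi> \<omega> A) B \<partial>M)"
    unfolding countably_additive_def
  proof (intro allI impI)
    fix F :: "nat \<Rightarrow> (real \<times> real) set"
    assume F: "range F \<subseteq> sets (restrict_space borel Delta)" "disjoint_family F"
    have "suminf (\<lambda>i. \<integral>\<^sup>+\<omega>. emeasure (pd_measure k \<xi> \<omega> A) (F i) \<partial>M)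
        = (\<integral>\<^sup>+\<omega>. suminf (\<lambda>i. emeasure (pd_measure k \<xi> \<omega> A) (F i)) \<partial>M)"
      using F measurable_pd_measure[OF A] by (intro nn_integral_suminf[symmetric]) auto
    also have "\<dots> = (\<integral>\<^sup>+\<omega>. emeasure (pd_measure k \<xi> \<omega> A) (\<Union>(range F)) \<partial>M)"
      using F by (intro nn_integral_cong suminf_emeasure) (auto simp: sets_pd_measure)
    finally show "suminf (\<lambda>i. \<integral>\<^sup>+\<omega>. emeasure (pd_measure k \<xi> \<omega> A) (F i) \<partial>M)
        = (\<integral>\<^sup>+\<omega>. emeasure (pd_measure k \<xi> \<omega> A) (\<Union>(range F)) \<partial>M)" .
  qed
  moreover have "positive (sets (restrict_space borel Delta)) (\<lambda>B. \<integral>\<^sup>+\<omega>. emeasure (pd_measure k \<xi> \<omega> A) B \<partial>M)"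
    by (simp add: positive_def)
  ultimately show ?thesis
    unfolding pd_expectation_def
    using emeasure_measure_of_sigma[OF sigma_algebra_Delta _ _ B] by blast
qed

text \<open>
  The number of points of the diagram is bounded by a polynomial in the number of atoms, hence its mean
  is bounded by a moment of the point process.
\<close>

lemma pd_expectation_finite:
  assumes A: "A \<in> bounded_borel"
  shows "emeasure (pd_expectation k M \<xi> A) Delta < \<infinity>"
proof -
  let ?e = "3 * DIM('a) + 1"
  have "emeasure (pd_expectation k M \<xi> A) Delta = (\<integral>\<^sup>+\<omega>. emeasure (pd_measure k \<xi> \<omega> A) Delta \<partial>M)"
    by (rule emeasure_pd_expectation[OF A Delta_in_sets])
  also have "\<dots> \<le> (\<integral>\<^sup>+\<omega>. of_nat DIM('a) * emeasure (\<xi> \<omega>) A ^ ?e \<partial>M)"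
  proof (rule nn_integral_mono)
    fix \<omega> assume \<omega>: "\<omega> \<in> space M"
    let ?X = "atoms_in (\<xi> \<omega>) A"
    have "of_nat (size (pd_union k ?X)) \<le> (of_nat (DIM('a) * card ?X ^ ?e) :: ennreal)"
      unfolding of_nat_le_iff by (rule size_pd_union_le[OF card_atoms_le(1)[OF integer[OF \<omega>] A]])
    also have "\<dots> = of_nat DIM('a) * of_nat (card ?X) ^ ?e" by simp
    also have "\<dots> \<le> of_nat DIM('a) * emeasure (\<xi> \<omega>) A ^ ?e"
      by (intro mult_left_mono power_mono card_atoms_le(2)[OF integer[OF \<omega>] A]) auto
    finally show "emeasure (pd_measure k \<xi> \<omega> A) Delta \<le> of_nat DIM('a) * emeasure (\<xi> \<omega>) A ^ ?e"
      by (simp add: emeasure_pd_measure_Delta[OF \<omega> A])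
  qed
  also have "\<dots> = of_nat DIM('a) * (\<integral>\<^sup>+\<omega>. emeasure (\<xi> \<omega>) A ^ ?e \<partial>M)"
    by (intro nn_integral_cmult borel_measurable_power_ennreal measurable_counts[OF point_process A])
  also have "\<dots> < \<infinity>"
  proof -
    have "(\<integral>\<^sup>+\<omega>. emeasure (\<xi> \<omega>) A ^ ?e \<partial>M) < \<infinity>"
      by (rule moments[unfolded all_finite_moments_def, rule_format, OF _ A]) simp
    then show ?thesis by (simp add: ennreal_mult_less_top of_nat_less_top)
  qed
  finally show ?thesis .
qed

lemma bounded_diagram_pd_expectation:
  assumes A: "A \<in> bounded_borel" "A \<subseteq> cball 0 R"
  shows "bounded_diagram (pd_expectation k M \<xi> A) R"
proof
  show "sets (pd_expectation k M \<xi> A) = sets (restrict_space borel Delta)" by (rule sets_pd_expectation)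
  show "emeasure (pd_expectation k M \<xi> A) Delta < \<infinity>" by (rule pd_expectation_finite[OF A(1)])
  let ?N = "{x \<in> Delta. \<not> (0 \<le> fst x \<and> snd x \<le> R)}"
  note N = out_of_bounds_measurable[of R]
  have "emeasure (pd_measure k \<xi> \<omega> A) ?N = 0" if "\<omega> \<in> space M" for \<omega>
  proof -
    have "filter_mset (\<lambda>x. x \<in> ?N) (pd_union k (atoms_in (\<xi> \<omega>) A)) = {#}"
      using set_mset_diagram[OF that A] by auto
    then show ?thesis using N by (simp add: emeasure_pd_measure)
  qed
  then have "(\<integral>\<^sup>+\<omega>. emeasure (pd_measure k \<xi> \<omega> A) ?N \<partial>M) = (\<integral>\<^sup>+\<omega>. 0 \<partial>M)"
    by (intro nn_integral_cong) simp
  then have "?N \<in> null_sets (pd_expectation k M \<xi> A)"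
    using N by (simp add: null_sets_def sets_pd_expectation emeasure_pd_expectation[OF A(1)])
  moreover have "space (pd_expectation k M \<xi> A) = Delta"
    using sets_eq_imp_space_eq[OF sets_pd_expectation] by (simp add: space_restrict_space)
  ultimately show "AE x in pd_expectation k M \<xi> A. 0 \<le> fst x \<and> snd x \<le> R"
    by (intro AE_I') auto
qed

text \<open>
  If the diagram were almost surely empty, almost surely at most one point would fall into \<open>A\<close>, and the mean number
  of points would be at most one.
\<close>

lemma pd_expectation_nonzero:
  assumes simple: "simple_process M \<xi>" and A: "A \<in> bounded_borel"
    and inten: "1 < (\<integral>\<^sup>+\<omega>. emeasure (\<xi> \<omega>) A \<partial>M)"
  shows "emeasure (pd_expectation k M \<xi> A) Delta \<noteq> 0"
proof
  assume "emeasure (pd_expectation k M \<xi> A) Delta = 0"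
  then have "(\<integral>\<^sup>+\<omega>. emeasure (pd_measure k \<xi> \<omega> A) Delta \<partial>M) = 0"
    by (simp add: emeasure_pd_expectation[OF A Delta_in_sets])
  then have "AE \<omega> in M. emeasure (pd_measure k \<xi> \<omega> A) Delta = 0"
    using nn_integral_0_iff_AE[OF measurable_pd_measure[OF A Delta_in_sets]] by simp
  moreover have "AE \<omega> in M. \<forall>x. emeasure (\<xi> \<omega>) {x} \<le> 1"
    using simple by (simp add: simple_process_def)
  moreover have "AE \<omega> in M. \<omega> \<in> space M" by (rule AE_space)
  ultimately have "AE \<omega> in M. emeasure (\<xi> \<omega>) A \<le> 1"
  proof eventually_elim
    case (elim \<omega>)
    show ?case
    proof (rule ccontr)
      assume "\<not> emeasure (\<xi> \<omega>) A \<le> 1"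
      then have "1 < emeasure (\<xi> \<omega>) A" by (simp add: not_le)
      moreover have "\<And>x. emeasure (\<xi> \<omega>) {x} \<le> 1" using elim(2) by blast
      ultimately obtain x y where xy: "x \<in> atoms_in (\<xi> \<omega>) A" "y \<in> atoms_in (\<xi> \<omega>) A" "x \<noteq> y"
        using two_atoms[OF integer[OF elim(3)] _ A] by blast
      have fin: "finite (atoms_in (\<xi> \<omega>) A)" by (rule card_atoms_le(1)[OF integer[OF elim(3)] A])
      have "card {x, y} \<le> card (atoms_in (\<xi> \<omega>) A)" using xy fin by (intro card_mono) auto
      then have "pd_union k (atoms_in (\<xi> \<omega>) A) \<noteq> {#}"
        using xy(3) by (intro pd_union_nonempty fin) simp
      then show False using elim(1) by (simp add: emeasure_pd_measure_Delta[OF elim(3) A])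
    qed
  qed
  then have "(\<integral>\<^sup>+\<omega>. emeasure (\<xi> \<omega>) A \<partial>M) \<le> (\<integral>\<^sup>+\<omega>. 1 \<partial>M)" by (rule nn_integral_mono_AE)
  then show False using inten by (simp add: emeasure_space_1)
qed

text \<open>
  The packing inequality for a single realisation, multiplied by \<open>l\<^sub>q\<^sup>q\<close>. In an empty diagram the integral
  vanishes. Otherwise the maximal death is attained at a point of the diagram, and no point dies after \<open>D\<close>.
\<close>

lemma pers_moment_le_of_packing:
  fixes q C \<delta> D :: real
  assumes A: "A \<in> bounded_borel" and \<omega>: "\<omega> \<in> space M" and pos: "0 < q" "0 \<le> C" "0 < \<delta>"
    and packing: "pd_number (pd_measure k \<xi> \<omega> A) \<le>
      C * (max_death (pd_measure k \<xi> \<omega> A) powr \<delta> / mean_pers q (pd_measure k \<xi> \<omega> A) powr q)"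
    and D: "0 < D" "emeasure (pd_measure k \<xi> \<omega> A) {x \<in> Delta. D < snd x} = 0"
  shows "(\<integral>\<^sup>+x. ennreal (pers x powr q) \<partial>pd_measure k \<xi> \<omega> A) \<le> ennreal (C * D powr \<delta>)"
proof -
  let ?\<rho> = "pd_measure k \<xi> \<omega> A"
  let ?X = "pd_union k (atoms_in (\<xi> \<omega>) A)"
  obtain R where R: "A \<subseteq> cball 0 R"
    using A by (rule bounded_borel_subset_cball)
  interpret \<rho>: bounded_diagram ?\<rho> R by (rule bounded_diagram_pd_measure[OF \<omega> A R])
  show ?thesis
  proof (cases "emeasure ?\<rho> Delta = 0")
    case True
    then have "Delta \<in> null_sets ?\<rho>" using Delta_in_sets by (simp add: null_sets_def sets_pd_measure)
    then have "AE x in ?\<rho>. ennreal (pers x powr q) = 0"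
      by (rule AE_I') (auto simp: \<rho>.space_eq)
    then have "(\<integral>\<^sup>+x. ennreal (pers x powr q) \<partial>?\<rho>) = (\<integral>\<^sup>+x. 0 \<partial>?\<rho>)" by (rule nn_integral_cong_AE)
    then show ?thesis by simp
  next
    case False
    let ?I = "\<integral>x. pers x powr q \<partial>?\<rho>"
    have I: "0 < ?I" by (rule \<rho>.pers_moment_pos[OF pos(1) False])
    have N: "0 < pd_number ?\<rho>" "pd_number ?\<rho> * mean_pers q ?\<rho> powr q = ?I"
      by (rule \<rho>.number_times_mean_pers[OF pos(1) False])+
    have sub: "set_mset ?X \<subseteq> {(b, d). b < d \<and> 0 \<le> b \<and> d \<le> R}" by (rule set_mset_diagram[OF \<omega> A R])
    have ne: "set_mset ?X \<noteq> {}" using False by (auto simp: emeasure_pd_measure_Delta[OF \<omega> A])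
    have md: "max_death ?\<rho> = Max (snd ` set_mset ?X)"
      unfolding pd_measure_def using sub by (intro max_death_diagram_measure) (auto simp: Delta_def)
    have S: "{x \<in> Delta. D < snd x} \<in> sets (restrict_space borel Delta)"
    proof -
      have "{x :: real \<times> real. D < snd x} \<in> sets borel"
        by (intro borel_open open_Collect_less continuous_intros)
      then have "Delta \<inter> {x. D < snd x} \<in> sets borel" using sets_borel_Delta by (intro sets.Int)
      moreover have "{x \<in> Delta. D < snd x} = Delta \<inter> {x. D < snd x}" by blast
      ultimately show ?thesis by (simp add: sets_restrict_Delta)
    qed
    have "filter_mset (\<lambda>x. x \<in> {x \<in> Delta. D < snd x}) ?X = {#}"
      using D(2) unfolding emeasure_pd_measure[OF S] by simp
    moreover have "x \<in> Delta" "0 \<le> snd x" if "x \<in># ?X" for x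
      using that sub by (auto simp: Delta_def)
    ultimately have le_D: "snd x \<le> D" and nn: "0 \<le> snd x" if "x \<in># ?X" for x
      using that by (cases x; auto simp: not_less)+
    have "max_death ?\<rho> \<le> D" unfolding md using ne le_D by (intro Max.boundedI) auto
    moreover have "0 \<le> max_death ?\<rho>"
    proof -
      obtain x where x: "x \<in># ?X" using ne by blast
      then have "0 \<le> snd x" by (rule nn)
      also have "snd x \<le> max_death ?\<rho>" unfolding md using x by (intro Max_ge) auto
      finally show ?thesis .
    qed
    ultimately have md_le: "max_death ?\<rho> powr \<delta> \<le> D powr \<delta>" using pos by (intro powr_mono2) auto
    have L: "0 < mean_pers q ?\<rho> powr q" using zero_less_mult_pos[of "pd_number ?\<rho>" "mean_pers q ?\<rho> powr q"] I N by simp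
    have "?I \<le> C * (max_death ?\<rho> powr \<delta> / mean_pers q ?\<rho> powr q) * mean_pers q ?\<rho> powr q"
      unfolding N(2)[symmetric] using packing L by (intro mult_right_mono) auto
    also have "\<dots> = C * max_death ?\<rho> powr \<delta>" using L by simp
    also have "\<dots> \<le> C * D powr \<delta>" using md_le pos by (intro mult_left_mono) auto
    finally have "?I \<le> C * D powr \<delta>" .
    then show ?thesis
      by (subst nn_integral_eq_integral[OF \<rho>.integrable_pers_powr[OF pos(1)]]) (auto intro: ennreal_leI)
  qed
qed

text \<open>
  The packing inequality for the expectation measure. Passing to expectations needs a deterministic bound for the
  maximal death of a realisation: the essential supremum \<open>D\<close> of the deaths is one, because
  a set that is null for the expectation measure is almost surely null for the random one.
\<close>

lemma extent_ratio_lower_bound: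
  fixes n C \<delta> :: real
  assumes A: "A \<in> bounded_borel" and pos: "0 < n" "0 < C" "0 < \<delta>"
    and packing: "AE \<omega> in M. pd_number (pd_measure k \<xi> \<omega> A) \<le>
      C * (max_death (pd_measure k \<xi> \<omega> A) powr \<delta> / mean_pers (n + \<delta>) (pd_measure k \<xi> \<omega> A) powr (n + \<delta>))"
    and nz: "emeasure (pd_expectation k M \<xi> A) Delta \<noteq> 0"
  shows "1 \<le> C * extent_ratio n \<delta> (pd_expectation k M \<xi> A)"
proof -
  let ?p = "pd_expectation k M \<xi> A"
  let ?q = "n + \<delta>"
  have q: "0 < ?q" using pos by simp
  obtain R where R: "A \<subseteq> cball 0 R"
    using A by (rule bounded_borel_subset_cball)
  interpret p: bounded_diagram ?p R by (rule bounded_diagram_pd_expectation[OF A R])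
  obtain D where D: "0 < D" "AE x in ?p. snd x \<le> D"
    "((\<lambda>p. (\<integral>x. snd x powr p \<partial>?p) powr (1 / p)) \<longlongrightarrow> D) at_top"
    by (rule p.death_Lp_limit[OF nz])
  let ?S = "{x \<in> Delta. D < snd x}"
  have S: "?S \<in> sets ?p"
  proof -
    have "{x \<in> space ?p. D < snd x} \<in> sets ?p" by measurable
    then show ?thesis by (simp only: p.space_eq)
  qed
  then have S': "?S \<in> sets (restrict_space borel Delta)" by (simp add: sets_pd_expectation)
  have "emeasure ?p ?S = 0"
    using D(2) by (subst (asm) AE_iff_measurable[OF S]) (simp_all add: p.space_eq not_le)
  then have "AE \<omega> in M. emeasure (pd_measure k \<xi> \<omega> A) ?S = 0"
    using nn_integral_0_iff_AE[OF measurable_pd_measure[OF A S']]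
    by (simp add: emeasure_pd_expectation[OF A S'])
  with packing AE_space
  have "AE \<omega> in M. (\<integral>\<^sup>+x. ennreal (pers x powr ?q) \<partial>pd_measure k \<xi> \<omega> A) \<le> ennreal (C * D powr \<delta>)"
  proof eventually_elim
    case (elim \<omega>)
    show ?case
      by (rule pers_moment_le_of_packing[OF A elim(2) q _ pos(3) elim(1) D(1) elim(3)]) (use pos in simp)
  qed
  then have "(\<integral>\<^sup>+\<omega>. (\<integral>\<^sup>+x. ennreal (pers x powr ?q) \<partial>pd_measure k \<xi> \<omega> A) \<partial>M)
      \<le> (\<integral>\<^sup>+\<omega>. ennreal (C * D powr \<delta>) \<partial>M)"
    by (rule nn_integral_mono_AE)
  also have "\<dots> = ennreal (C * D powr \<delta>)" by (simp add: emeasure_space_1)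
  also have "(\<integral>\<^sup>+\<omega>. (\<integral>\<^sup>+x. ennreal (pers x powr ?q) \<partial>pd_measure k \<xi> \<omega> A) \<partial>M)
      = (\<integral>\<^sup>+x. ennreal (pers x powr ?q) \<partial>?p)"
  proof -
    have "(\<lambda>x. ennreal (pers x powr ?q)) \<in> borel_measurable (restrict_space borel Delta)"
      using p.measurable_pers unfolding p.measurable_eq by measurable
    then have "(\<lambda>\<omega>. \<integral>\<^sup>+x. ennreal (pers x powr ?q) \<partial>pd_measure k \<xi> \<omega> A) \<in> borel_measurable M \<and>
        (\<integral>\<^sup>+x. ennreal (pers x powr ?q) \<partial>?p)
          = (\<integral>\<^sup>+\<omega>. (\<integral>\<^sup>+x. ennreal (pers x powr ?q) \<partial>pd_measure k \<xi> \<omega> A) \<partial>M)"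
      by (intro nn_integral_mixture[where N = "restrict_space borel Delta"] sets_pd_expectation
          sets_pd_measure measurable_pd_measure[OF A] emeasure_pd_expectation[OF A])
    then show ?thesis by simp
  qed
  also have "\<dots> = ennreal (\<integral>x. pers x powr ?q \<partial>?p)"
    by (rule nn_integral_eq_integral[OF p.integrable_pers_powr[OF q]]) simp
  finally have "(\<integral>x. pers x powr ?q \<partial>?p) \<le> C * D powr \<delta>"
    using pos by (simp add: ennreal_le_iff)
  then show ?thesis
    using p.pers_moment_pos[OF q nz] p.max_death_expectation_eqI[OF D(3)]
    by (simp add: p.extent_ratio_eq[OF pos(1,3) nz])
qed

end

section \<open>Self-similar families\<close>

lemma convex_averaging_contains_ball:
  assumes "convex_averaging A"
  shows "\<forall>\<^sub>F j in sequentially. \<exists>x. ball x r \<subseteq> A j"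
proof -
  let ?S = "\<lambda>j. {s. 0 \<le> s \<and> (\<exists>x. ball x s \<subseteq> A j)}"
  have "filterlim (\<lambda>j. Sup (?S j)) at_top sequentially"
    using assms by (simp add: convex_averaging_def)
  then have "\<forall>\<^sub>F j in sequentially. r < Sup (?S j)" by (simp add: filterlim_at_top_dense)
  then show ?thesis
  proof eventually_elim
    case (elim j)
    have "0 \<in> ?S j" by simp
    then have "?S j \<noteq> {}" by blast
    from less_cSupD[OF this elim] obtain s where "s \<in> ?S j" "r < s" ..
    then obtain x where "ball x s \<subseteq> A j" by blast
    moreover have "ball x r \<subseteq> ball x s" using \<open>r < s\<close> by (intro subset_ball) simp
    ultimately show ?case by blast
  qed
qed

lemma eventually_pd_expectation_nonzero:
  fixes \<xi> :: "'w \<Rightarrow> 'a::euclidean_space measure" and k :: "'k::field itself"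
  assumes "diagram_process M k \<xi>" and simple: "simple_process M \<xi>" and st: "stationary M \<xi>"
    and inten: "positive_intensity M \<xi>" and A: "convex_averaging A"
  shows "\<forall>\<^sub>F j in sequentially. emeasure (pd_expectation k M \<xi> (A j)) Delta \<noteq> 0"
proof -
  interpret diagram_process M k \<xi> by fact
  obtain r0 where r0: "\<forall>B\<in>bounded_borel. \<forall>x. ball x r0 \<subseteq> B \<longrightarrow> 1 < (\<integral>\<^sup>+\<omega>. emeasure (\<xi> \<omega>) B \<partial>M)"
    using intensity_of_large_ball[OF point_process st inten] ..
  from convex_averaging_contains_ball[OF A, of r0] show ?thesis
  proof eventually_elim
    case (elim j)
    then obtain x where x: "ball x r0 \<subseteq> A j" ..
    have Aj: "A j \<in> bounded_borel" using A by (simp add: convex_averaging_def)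
    show ?case by (rule pd_expectation_nonzero[OF simple Aj r0[rule_format, OF Aj x]])
  qed
qed

text \<open>
  According to the sign of \<open>a\<close>, the lower bound for \<open>x'\<close> makes \<open>x\<close> large, or the lower bound for \<open>x\<close>
  makes \<open>x'\<close> large; in both cases the larger one is at least \<open>s\<^bsup>|a|\<^esup> / C\<close>.
\<close>

lemma no_long_self_similar_interval:
  fixes s C x x' a :: real
  assumes s: "0 < s" and C: "0 < C" and a: "a \<noteq> 0" and scale: "x = s powr a * x'"
    and bounds: "1 \<le> C * x" "1 \<le> C * x'"
  shows "s \<le> (C * max x x') powr (1 / \<bar>a\<bar>)"
proof -
  have "s powr \<bar>a\<bar> \<le> C * max x x'"
  proof (cases "0 < a")
    case True
    have "s powr a * 1 \<le> s powr a * (C * x')" using bounds by (intro mult_left_mono) auto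
    also have "\<dots> = C * x" using scale by simp
    also have "\<dots> \<le> C * max x x'" using C by simp
    finally show ?thesis using True by simp
  next
    case False
    then have "s powr \<bar>a\<bar> * (s powr a) = 1" using s by (simp flip: powr_add)
    have "s powr \<bar>a\<bar> * 1 \<le> s powr \<bar>a\<bar> * (C * x)" using bounds by (intro mult_left_mono) auto
    also have "\<dots> = (s powr \<bar>a\<bar> * s powr a) * (C * x')" using scale by simp
    also have "\<dots> = C * x'" using \<open>s powr \<bar>a\<bar> * (s powr a) = 1\<close> by simp
    also have "\<dots> \<le> C * max x x'" using C by simp
    finally show ?thesis by simp
  qed
  then have "(s powr \<bar>a\<bar>) powr (1 / \<bar>a\<bar>) \<le> (C * max x x') powr (1 / \<bar>a\<bar>)"
    by (intro powr_mono2) auto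
  then show ?thesis using s a by (simp add: powr_powr)
qed

theorem theorem1p2:
  fixes M :: "'w measure"
    and \<xi> :: "real \<Rightarrow> 'w \<Rightarrow> (real ^ 'n) measure"
    and T0 T1 \<eta>1 \<eta>2 :: real
  assumes "prob_space M"
    and "0 < T0" and "T0 < T1"
    and "\<And>t. t \<in> {T0<..<T1} \<Longrightarrow> point_process M (\<xi> t)"
    and "\<And>t. t \<in> {T0<..<T1} \<Longrightarrow> simple_process M (\<xi> t)"
    and "\<And>t. t \<in> {T0<..<T1} \<Longrightarrow> stationary M (\<xi> t)"
    and "\<And>t. t \<in> {T0<..<T1} \<Longrightarrow> ergodic M (\<xi> t)"
    and "\<And>t. t \<in> {T0<..<T1} \<Longrightarrow> all_finite_moments M (\<xi> t)"
    and "\<And>t. t \<in> {T0<..<T1} \<Longrightarrow> positive_intensity M (\<xi> t)"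
    and "\<And>t. t \<in> {T0<..<T1} \<Longrightarrow> pd_expectation_exists TYPE('k::field) M (\<xi> t)"
    and "\<And>t. t \<in> {T0<..<T1} \<Longrightarrow>
           \<exists>A\<in>bounded_borel. emeasure (pd_expectation TYPE('k) M (\<xi> t) A) Delta \<noteq> 0"
    and "self_similar TYPE('k) M \<xi> T0 T1 \<eta>1 \<eta>2"
    and "sufficiently_extended TYPE('k) M \<xi> T0 T1 \<eta>1 \<eta>2"
  shows "AE \<omega> in M. \<eta>2 = real CARD('n) * \<eta>1"
proof -
  let ?n = "real DIM(real ^ 'n)"
  let ?p = "\<lambda>t. pd_expectation TYPE('k) M (\<xi> t)"
  have "\<eta>2 = ?n * \<eta>1"
  proof (rule ccontr)
    assume neq: "\<eta>2 \<noteq> ?n * \<eta>1"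
    obtain c \<delta> :: real and A :: "nat \<Rightarrow> (real ^ 'n) set" and t t' where
      c: "0 < c" and packing: "packing_inequality TYPE('k) M \<xi> T0 T1 c" and \<delta>: "0 < \<delta>"
      and A: "convex_averaging A" and t: "t \<in> {T0<..<T1}" and t': "t' \<in> {T0<..<T1}"
      and long: "\<forall>\<^sub>F j in sequentially. t / t' > (c * (?n + 2 * \<delta>) / \<delta> *
          max (extent_ratio ?n \<delta> (?p t (A j))) (extent_ratio ?n \<delta> (?p t' (A j))))
            powr (1 / \<bar>?n * \<eta>1 - \<eta>2\<bar>)"
      using assms(13)[unfolded sufficiently_extended_def, THEN mp, OF neq]
      by (elim exE conjE bexE) (rule that)
    define C where "C = c * (?n + 2 * \<delta>) / \<delta>"
    have n: "0 < ?n" by simp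
    then have C: "0 < C" unfolding C_def using c \<delta> by (intro divide_pos_pos mult_pos_pos add_pos_pos) auto
    have proc: "diagram_process M TYPE('k) (\<xi> u)" if "u \<in> {T0<..<T1}" for u
      by (intro diagram_process.intro diagram_process_axioms.intro assms(1) assms(4,8,10)[OF that])
    have nonzero: "\<forall>\<^sub>F j in sequentially. emeasure (?p u (A j)) Delta \<noteq> 0" if "u \<in> {T0<..<T1}" for u
      by (rule eventually_pd_expectation_nonzero[OF proc[OF that] assms(5,6,9)[OF that] A])
    from eventually_happens'[OF sequentially_bot eventually_conj[OF long eventually_conj[OF nonzero[OF t] nonzero[OF t']]]]
    obtain j where j: "t / t' > (C * max (extent_ratio ?n \<delta> (?p t (A j))) (extent_ratio ?n \<delta> (?p t' (A j))))
            powr (1 / \<bar>?n * \<eta>1 - \<eta>2\<bar>)"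
      and nz: "emeasure (?p t (A j)) Delta \<noteq> 0" "emeasure (?p t' (A j)) Delta \<noteq> 0"
      unfolding C_def[symmetric] by (elim exE conjE) (rule that)
    have Aj: "A j \<in> bounded_borel" using A by (simp add: convex_averaging_def)
    then obtain R where R: "A j \<subseteq> cball 0 R" by (rule bounded_borel_subset_cball)
    have lower: "1 \<le> C * extent_ratio ?n \<delta> (?p u (A j))"
      if u: "u \<in> {T0<..<T1}" and nz: "emeasure (?p u (A j)) Delta \<noteq> 0" for u
    proof (rule diagram_process.extent_ratio_lower_bound[OF proc[OF u] Aj n C \<delta> _ nz])
      show "AE \<omega> in M. pd_number (pd_measure TYPE('k) (\<xi> u) \<omega> (A j)) \<le>
        C * (max_death (pd_measure TYPE('k) (\<xi> u) \<omega> (A j)) powr \<delta> /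
             mean_pers (?n + \<delta>) (pd_measure TYPE('k) (\<xi> u) \<omega> (A j)) powr (?n + \<delta>))"
        using packing[unfolded packing_inequality_def, rule_format, OF \<delta> Aj u] unfolding C_def .
    qed
    define s where "s = t / t'"
    have s: "0 < s" using t t' assms(2) by (auto simp: s_def)
    have "extent_ratio ?n \<delta> (?p t (A j)) = (s powr (- \<eta>1)) powr ?n / s powr (- \<eta>2) * extent_ratio ?n \<delta> (?p t' (A j))"
    proof (rule extent_ratio_rescale[OF _ _ _ _ n \<delta> nz])
      show "bounded_diagram (?p t (A j)) R" "bounded_diagram (?p t' (A j)) R"
        using diagram_process.bounded_diagram_pd_expectation[OF proc Aj R] t t' by auto
      show "0 < s powr (- \<eta>1)" "0 < s powr (- \<eta>2)" using s by auto
      show "emeasure (?p t (A j)) B = ennreal (s powr (- \<eta>2)) *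
          emeasure (?p t' (A j)) ((\<lambda>(b, d). (s powr (- \<eta>1) * b, s powr (- \<eta>1) * d)) ` B)"
        if "B \<in> sets (restrict_space borel Delta)" for B
      proof -
        have B: "B \<in> sets borel" "B \<subseteq> Delta" using that by (simp_all add: sets_restrict_Delta)
        show ?thesis
          unfolding s_def by (rule assms(12)[unfolded self_similar_def, rule_format, OF t t' Aj B])
      qed
    qed
    also have "(s powr (- \<eta>1)) powr ?n / s powr (- \<eta>2) = s powr (\<eta>2 - ?n * \<eta>1)"
      using s by (simp add: powr_powr mult.commute flip: powr_diff)
    finally have "s \<le> (C * max (extent_ratio ?n \<delta> (?p t (A j))) (extent_ratio ?n \<delta> (?p t' (A j))))
            powr (1 / \<bar>\<eta>2 - ?n * \<eta>1\<bar>)"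
      using neq by (intro no_long_self_similar_interval[OF s C _ _ lower[OF t nz(1)] lower[OF t' nz(2)]]) auto
    then show False using j by (simp add: s_def abs_minus_commute)
  qed
  then show ?thesis by simp
qed

end
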